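(* Let $B_1\subset\mathbb{R}^3$ be the unit ball and $S_1=\partial B_1$. Let $p$ be the solution of $$p_{tt}-\Delta p=0,\quad x\in\mathbb{R}^3,\ t>0,\qquad p|_{t=0}=a(x),\quad p_t|_{t=0}=b(x),$$ where the supports of $a$ and $b$ are located inside $S_1$. Let $F:=p|_{S_1\times[0,T]}$ be known for a time $T\geqslant 2$, and set $\widetilde F(\cdot,t)=F(\cdot,2-t)$. Let $u$ be the solution of the interior problem $$u_{tt}-\Delta u=0,\quad |x|<1,\ 0<t<2,\qquad u|_{S_1\times[0,2]}=\widetilde F,\qquad u|_{t=0}=u_t|_{t=0}=0.$$ Then the unknown functions $a$ and $b$ are equal to $$a(x)=u(x,2),\qquad b(x)=-u_t(x,2).$$
   Context: The interior problem arises by the change of variable $t\mapsto 2-t$ from the problem for the wave equation in the cylinder $|x|<1$, $0<t<2$, with boundary data $F$ and zero Cauchy data at $t=2$. The zero data are motivated by the presence of a trailing edge of the wave in dimension three: the solution $p$ vanishes for $|x|\leqslant 1$ at times greater than $2$. *)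

theory Defs
  imports "HOL-Analysis.Analysis"
begin

text \<open>Derivatives are taken within the set, so that on a closed convex set with nonempty interior
  (where they are unique) these classes mean regularity up to the boundary.\<close>

definition C1_on :: "('a::real_normed_vector \<Rightarrow> 'b::real_normed_vector) \<Rightarrow> 'a set \<Rightarrow> bool" where
  "C1_on f S \<longleftrightarrow> (\<exists>D :: 'a \<Rightarrow> 'a \<Rightarrow>\<^sub>L 'b.
     (\<forall>z\<in>S. (f has_derivative blinfun_apply (D z)) (at z within S)) \<and> continuous_on S D)"

definition C2_on :: "('a::real_normed_vector \<Rightarrow> 'b::real_normed_vector) \<Rightarrow> 'a set \<Rightarrow> bool" where
  "C2_on f S \<longleftrightarrow> (\<exists>D :: 'a \<Rightarrow> 'a \<Rightarrow>\<^sub>L 'b.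
     (\<forall>z\<in>S. (f has_derivative blinfun_apply (D z)) (at z within S)) \<and> C1_on D S)"

definition laplacian :: "('a::euclidean_space \<Rightarrow> real) \<Rightarrow> 'a \<Rightarrow> real" where
  "laplacian f x = (\<Sum>e\<in>Basis. (deriv ^^ 2) (\<lambda>s. f (x + s *\<^sub>R e)) 0)"

definition wave_eq_at :: "('a::euclidean_space \<Rightarrow> real \<Rightarrow> real) \<Rightarrow> 'a \<Rightarrow> real \<Rightarrow> bool" where
  "wave_eq_at v x t \<longleftrightarrow> (deriv ^^ 2) (\<lambda>s. v x s) t - laplacian (\<lambda>y. v y t) x = 0"

text \<open>Classical solutions: twice continuously differentiable where the equation holds and once
  continuously differentiable up to the boundary, where the data are attained; time derivatives at
  the ends of the time interval are one-sided.\<close>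

definition cauchy_solution ::
    "(real^3 \<Rightarrow> real) \<Rightarrow> (real^3 \<Rightarrow> real) \<Rightarrow> (real^3 \<Rightarrow> real \<Rightarrow> real) \<Rightarrow> bool" where
  "cauchy_solution a b p \<longleftrightarrow>
     C2_on (\<lambda>(x, t). p x t) (UNIV \<times> {0<..}) \<and>
     C1_on (\<lambda>(x, t). p x t) (UNIV \<times> {0..}) \<and>
     (\<forall>x. \<forall>t>0. wave_eq_at p x t) \<and>
     (\<forall>x. p x 0 = a x) \<and>
     (\<forall>x. ((\<lambda>t. p x t) has_real_derivative b x) (at 0 within {0..}))"

definition interior_solution ::
    "(real^3 \<Rightarrow> real \<Rightarrow> real) \<Rightarrow> (real^3 \<Rightarrow> real \<Rightarrow> real) \<Rightarrow> bool" where
  "interior_solution G u \<longleftrightarrow>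
     C2_on (\<lambda>(x, t). u x t) (ball 0 1 \<times> {0<..<2}) \<and>
     C1_on (\<lambda>(x, t). u x t) (cball 0 1 \<times> {0..2}) \<and>
     (\<forall>x\<in>ball 0 1. \<forall>t\<in>{0<..<2}. wave_eq_at u x t) \<and>
     (\<forall>x\<in>sphere 0 1. \<forall>t\<in>{0..2}. u x t = G x t) \<and>
     (\<forall>x\<in>ball 0 1. u x 0 = 0) \<and>
     (\<forall>x\<in>ball 0 1. ((\<lambda>t. u x t) has_real_derivative 0) (at 0 within {0..2}))"

end

theory Submission
  imports Defs
begin

text \<open>By Huygens' principle in dimension three, \<open>p\<close> and \<open>p\<^sub>t\<close> vanish on the closed unit ball at time
  \<open>2\<close>. Hence \<open>w(x, t) = u(x, t) - p(x, 2 - t)\<close> solves the wave equation in the cylinder with zero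
  Cauchy data and zero boundary values, so \<open>w = 0\<close>, and \<open>a\<close>, \<open>b\<close> are read off at \<open>t = 2\<close>.

  Both parts are done by volume integrals only. Uniqueness: the energy is weighted with a cutoff
  \<open>\<phi>\<close> that drops from \<open>2\<close> to \<open>0\<close> in a shell of width \<open>\<delta>\<close> at the sphere; its time derivative is an
  integral of \<open>w\<^sub>t \<nabla>w \<bullet> \<nabla>\<phi>\<close> over the shell, where \<open>\<nabla>\<phi> = O(1/\<delta>)\<close>, the volume is \<open>O(\<delta>)\<close>, and
  \<open>w\<^sub>t\<close> is small because it is continuous up to the boundary and vanishes there.
  Huygens: \<open>p\<close> is tested against the spherical waves
  \<open>\<psi>(y, \<tau>) = (h(\<tau> + |y|) - h(\<tau> - |y|)) / |y|\<close> with \<open>h\<close> even and supported in \<open>[-\<epsilon>, \<epsilon>]\<close>. At time \<open>0\<close> the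
  wave \<open>\<psi>(\<sqdot>, t\<^sub>0)\<close> lives in the shell \<open>||y| - t\<^sub>0| < \<epsilon>\<close>, which misses the data, and at time \<open>t\<^sub>0\<close> the pairing
  is an average of \<open>p(\<sqdot>, t\<^sub>0)\<close> against the weight \<open>2 h'(|y|) / |y|\<close> of constant sign.\<close>

section \<open>Differentiation under the integral\<close>

text \<open>The divergence theorem enters both halves only through translation invariance of
  Lebesgue measure, in the form \<open>integral_directional_derivative_eq_0\<close>; this asks for
  fields of bounded support. For the energy the cutoff also answers an obstacle in the regularity
  class: second derivatives exist in the open cylinder only and may blow up at its boundary, so the
  balance is taken where they are bounded, and the limit \<delta> \<rightarrow> 0 sees first
  derivatives alone. For the test waves, |y| \<psi> solves the one-dimensional wave equation, and in
  dimension three this makes \<psi> a solution of the wave equation. The difference h(\<tau> + r) -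
  h(\<tau> - r) is odd in r, which keeps \<psi> bounded at the origin. Evenness of h makes \<psi>
  vanish at \<tau> = 0, so the pairing at time t0 has lost its term with the time derivative of p.
  Supports inside the open ball have a radius \<rho> < 1. Then p vanishes where |x| + \<rho> < t,
  and the slack 2 - (1 + \<rho>) gives p = 0 on a whole time interval around 2, hence also a zero
  time derivative there.\<close>

lemma has_real_derivative_integral_dominated:
  fixes f f' :: "'a \<Rightarrow> real \<Rightarrow> real"
  assumes r: "r > 0"
    and int: "\<And>t. \<bar>t - t0\<bar> < r \<Longrightarrow> integrable M (\<lambda>x. f x t)"
    and der: "AE x in M. \<forall>t. \<bar>t - t0\<bar> < r \<longrightarrow> (f x has_real_derivative f' x t) (at t) \<and> \<bar>f' x t\<bar> \<le> B x"
    and B: "integrable M B"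
    and meas: "(\<lambda>x. f' x t0) \<in> borel_measurable M"
  shows "((\<lambda>t. \<integral>x. f x t \<partial>M) has_real_derivative (\<integral>x. f' x t0 \<partial>M)) (at t0)"
  unfolding has_field_derivative_iff tendsto_at_iff_sequentially comp_def
proof (intro allI impI)
  fix X :: "nat \<Rightarrow> real"
  assume X: "\<forall>i. X i \<in> UNIV - {t0}" and lim: "X \<longlonglongrightarrow> t0"
  then obtain N where N: "\<bar>X n - t0\<bar> < r" if "n \<ge> N" for n
    using r unfolding lim_sequentially dist_real_def by blast
  \<comment> \<open>Dominated convergence asks for its bound at every index, so the terms outside
    the \<open>r\<close>-neighbourhood are dropped; \<open>LIMSEQ_offset\<close> restores them at
    the end.\<close>
  define Y where "Y n = X (n + N)" for n
  have Y: "\<bar>Y n - t0\<bar> < r" "Y n \<noteq> t0" for n using N X by (auto simp: Y_def)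
  have limY: "Y \<longlonglongrightarrow> t0" using lim unfolding Y_def by (rule LIMSEQ_ignore_initial_segment)
  let ?q = "\<lambda>n x. (f x (Y n) - f x t0) / (Y n - t0)"
  have "(\<lambda>n. \<integral>x. ?q n x \<partial>M) \<longlonglongrightarrow> (\<integral>x. f' x t0 \<partial>M)"
  proof (rule integral_dominated_convergence[where w = B])
    show "AE x in M. (\<lambda>n. ?q n x) \<longlonglongrightarrow> f' x t0"
      using der
    proof eventually_elim
      case (elim x)
      then have "(f x has_real_derivative f' x t0) (at t0)" using r by auto
      then show ?case
        using limY Y(2) unfolding has_field_derivative_iff tendsto_at_iff_sequentially comp_def by auto
    qed
    show "AE x in M. norm (?q n x) \<le> B x" for n
      using der
    proof eventually_elim
      case (elim x)
      \<comment> \<open>The mean value inequality makes \<open>B x\<close> dominate every difference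
        quotient, not only the derivative.\<close>
      have "norm (f x (Y n) - f x t0) \<le> B x * norm (Y n - t0)"
      proof (rule field_differentiable_bound[where S = "{t. \<bar>t - t0\<bar> < r}" and f' = "f' x"])
        have "{t. \<bar>t - t0\<bar> < r} = ball t0 r" by (auto simp: dist_real_def)
        then show "convex {t. \<bar>t - t0\<bar> < r}" by simp
      qed (use elim Y r in \<open>auto intro: has_field_derivative_at_within\<close>)
      then show ?case using Y(2)[of n] by (simp add: divide_simps)
    qed
  qed (use int Y r B meas in \<open>auto intro!: borel_measurable_divide borel_measurable_diff borel_measurable_integrable\<close>)
  moreover have "(\<integral>x. ?q n x \<partial>M) = ((\<integral>x. f x (Y n) \<partial>M) - (\<integral>x. f x t0 \<partial>M)) / (Y n - t0)" for n
    using int[OF Y(1)] int[of t0] r by simp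
  ultimately have "(\<lambda>n. ((\<integral>x. f x (Y n) \<partial>M) - (\<integral>x. f x t0 \<partial>M)) / (Y n - t0)) \<longlonglongrightarrow> (\<integral>x. f' x t0 \<partial>M)"
    by (simp only:)
  then show "(\<lambda>n. ((\<integral>x. f x (X n) \<partial>M) - (\<integral>x. f x t0 \<partial>M)) / (X n - t0)) \<longlonglongrightarrow> (\<integral>x. f' x t0 \<partial>M)"
    unfolding Y_def by (rule LIMSEQ_offset)
qed

lemma continuous_on_integral_dominated:
  fixes f :: "'a \<Rightarrow> real \<Rightarrow> real"
  assumes cont: "AE x in M. continuous_on S (f x) \<and> (\<forall>t\<in>S. \<bar>f x t\<bar> \<le> B x)"
    and B: "integrable M B"
    and meas: "\<And>t. t \<in> S \<Longrightarrow> (\<lambda>x. f x t) \<in> borel_measurable M"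
  shows "continuous_on S (\<lambda>t. \<integral>x. f x t \<partial>M)"
  unfolding continuous_on_sequentially comp_def
proof (intro allI ballI impI)
  fix X t assume t: "t \<in> S" and "(\<forall>n. X n \<in> S) \<and> X \<longlonglongrightarrow> t"
  then have X: "X n \<in> S" "X \<longlonglongrightarrow> t" for n by auto
  show "(\<lambda>n. \<integral>x. f x (X n) \<partial>M) \<longlonglongrightarrow> (\<integral>x. f x t \<partial>M)"
  proof (rule integral_dominated_convergence[where w = B])
    show "AE x in M. (\<lambda>n. f x (X n)) \<longlonglongrightarrow> f x t"
      using cont by eventually_elim (use t X in \<open>auto simp: continuous_on_sequentially comp_def\<close>)
    show "AE x in M. norm (f x (X n)) \<le> B x" for n
      using cont by eventually_elim (use X in auto)
  qed (use B meas X t in auto)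
qed

section \<open>Integration by parts through translation invariance\<close>

lemma lborel_integral_translate:
  fixes f :: "'a::euclidean_space \<Rightarrow> real"
  assumes "f \<in> borel_measurable borel"
  shows "(\<integral>x. f (x + c) \<partial>lborel) = (\<integral>x. f x \<partial>lborel)"
proof -
  have "(\<integral>x. f x \<partial>lborel) = (\<integral>x. f x \<partial>(distr lborel borel ((+) c)))"
    using lborel_distr_plus[of c] by simp
  also have "\<dots> = (\<integral>x. f (c + x) \<partial>lborel)"
    using assms by (subst integral_distr) auto
  finally show ?thesis by (simp add: add.commute)
qed

lemma integrable_indicator_cball:
  "integrable lborel (\<lambda>x::'a::euclidean_space. B * indicator (cball c r) x :: real)"
  using emeasure_lborel_cball_finite[of c r]
  by (intro integrable_mult_right integrable_real_indicator) (auto simp: infinity_ennreal_def)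

lemma integrable_bounded_support:
  fixes f :: "'a::euclidean_space \<Rightarrow> real"
  assumes "f \<in> borel_measurable borel" "\<And>x. \<bar>f x\<bar> \<le> C" "\<And>x. norm x > R \<Longrightarrow> f x = 0"
  shows "integrable lborel f"
proof (rule Bochner_Integration.integrable_bound)
  show "integrable lborel (\<lambda>x::'a. C * indicator (cball 0 R) x)"
    by (rule integrable_indicator_cball)
  show "AE x in lborel. norm (f x) \<le> norm (C * indicator (cball 0 R) x)"
    using assms(2,3) by (auto simp: indicator_def intro!: AE_I2 order_trans[OF _ abs_ge_self])
qed (use assms in auto)

text \<open>Translation invariance makes the integral of \<open>V (x + s e)\<close> independent of \<open>s\<close>; this is its
  derivative at \<open>s = 0\<close>.\<close>

lemma integral_directional_derivative_eq_0:
  fixes V g :: "'a::euclidean_space \<Rightarrow> real"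
  assumes V: "V \<in> borel_measurable borel" "\<And>x. \<bar>V x\<bar> \<le> C" "\<And>x. norm x > R \<Longrightarrow> V x = 0"
    and g: "g \<in> borel_measurable borel"
    and N: "AE x in lborel. x \<notin> N" "\<And>x s. x \<notin> N \<Longrightarrow> x + s *\<^sub>R e \<notin> N"
    and der: "\<And>x. x \<notin> N \<Longrightarrow> ((\<lambda>s. V (x + s *\<^sub>R e)) has_real_derivative g x) (at 0)"
    and bd: "\<And>x. x \<notin> N \<Longrightarrow> \<bar>g x\<bar> \<le> B"
  shows "(\<integral>x. g x \<partial>lborel) = 0"
proof -
  \<comment> \<open>\<open>V\<close> is zero near \<open>x\<close>, so its derivative along the line
    is zero; off \<open>N\<close> this gives \<open>g\<close> the bounded support that the
    domination needs.\<close>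
  have g0: "g x = 0" if "x \<notin> N" "norm x > R" for x
  proof -
    have "((\<lambda>s. x + s *\<^sub>R e) \<longlongrightarrow> x + 0 *\<^sub>R e) (at 0)"
      by (intro tendsto_intros)
    then have "\<forall>\<^sub>F s in at 0. x + s *\<^sub>R e \<in> - cball 0 R"
      using that by (intro topological_tendstoD) (auto simp: open_Compl)
    then have "\<forall>\<^sub>F s in nhds 0. V (x + s *\<^sub>R e) = 0"
      using that V(3) unfolding eventually_at_filter by (elim eventually_mono) (use that V(3) in force)
    then have "((\<lambda>s. V (x + s *\<^sub>R e)) has_real_derivative 0) (at 0)"
      by (subst DERIV_cong_ev[OF refl _ refl]) auto
    with der[OF that(1)] show ?thesis by (rule DERIV_unique)
  qed
  \<comment> \<open>With \<open>r = 1\<close> a translation moves the support by at most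
    \<open>norm e\<close>, whence the ball of radius \<open>R + norm e\<close>.\<close>
  have "((\<lambda>s. \<integral>x. V (x + s *\<^sub>R e) \<partial>lborel) has_real_derivative (\<integral>x. g (x + 0 *\<^sub>R e) \<partial>lborel)) (at 0)"
  proof (rule has_real_derivative_integral_dominated[where r = 1 and B = "\<lambda>x. B * indicator (cball 0 (R + norm e)) x"])
    show "integrable lborel (\<lambda>x. V (x + t *\<^sub>R e))" for t
    proof (rule integrable_bounded_support[where C = C and R = "R + norm (t *\<^sub>R e)"])
      show "V (x + t *\<^sub>R e) = 0" if "R + norm (t *\<^sub>R e) < norm x" for x
        using that norm_diff_ineq[of x "t *\<^sub>R e"] by (intro V(3)) linarith
    qed (use V in auto)
    show "AE x in lborel. \<forall>t. \<bar>t - 0\<bar> < 1 \<longrightarrow>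
       ((\<lambda>t. V (x + t *\<^sub>R e)) has_real_derivative g (x + t *\<^sub>R e)) (at t) \<and>
       \<bar>g (x + t *\<^sub>R e)\<bar> \<le> B * indicator (cball 0 (R + norm e)) x"
      using N(1)
    proof eventually_elim
      case (elim x)
      \<comment> \<open>The derivative at \<open>t\<close> is the derivative at 0 seen from the
        translated point, which must again avoid \<open>N\<close>; this is why the complement of
        \<open>N\<close> is taken invariant under translations along \<open>e\<close>.\<close>
      have "((\<lambda>t. V (x + t *\<^sub>R e)) has_real_derivative g (x + t *\<^sub>R e)) (at t)" for t
      proof -
        have "((\<lambda>s. V ((x + t *\<^sub>R e) + s *\<^sub>R e)) has_real_derivative g (x + t *\<^sub>R e)) (at 0)"
          by (rule der) (use N elim in auto)
        then have "((\<lambda>s. V (x + (s + t) *\<^sub>R e)) has_real_derivative g (x + t *\<^sub>R e)) (at 0)"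
          by (simp add: algebra_simps)
        then show ?thesis using DERIV_shift[of "\<lambda>t. V (x + t *\<^sub>R e)" _ 0 t] by simp
      qed
      moreover have "\<bar>g (x + t *\<^sub>R e)\<bar> \<le> B * indicator (cball 0 (R + norm e)) x" if "\<bar>t\<bar> < 1" for t
      proof (cases "x \<in> cball 0 (R + norm e)")
        case True
        then show ?thesis using bd[OF N(2)[OF elim]] by simp
      next
        case False
        have "norm (t *\<^sub>R e) \<le> norm e"
          using that by (simp add: mult_left_le_one_le)
        then have "norm (x + t *\<^sub>R e) > R"
          using False norm_diff_ineq[of x "t *\<^sub>R e"] by simp
        then show ?thesis using g0[OF N(2)[OF elim]] False by simp
      qed
      ultimately show ?case by simp
    qed
    show "integrable lborel (\<lambda>x::'a. B * indicator (cball 0 (R + norm e)) x)"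
      by (rule integrable_indicator_cball)
  qed (use g in auto)
  moreover have "(\<lambda>s. \<integral>x. V (x + s *\<^sub>R e) \<partial>lborel) = (\<lambda>s. \<integral>x. V x \<partial>lborel)"
    using lborel_integral_translate[OF V(1)] by simp
  ultimately have "((\<lambda>s::real. \<integral>x. V x \<partial>lborel) has_real_derivative (\<integral>x. g x \<partial>lborel)) (at 0)"
    by simp
  then show ?thesis using DERIV_const DERIV_unique by blast
qed

section \<open>Twice continuously differentiable functions\<close>

text \<open>Meant for the time reversal \<open>(x, 2 - t)\<close>, which is \<open>c + L z\<close>
  with \<open>c = (0, 2)\<close> and \<open>L (x, t) = (x, - t)\<close>.\<close>

lemma C1_on_affine:
  assumes f: "C1_on f S" and L: "bounded_linear L" and T: "\<And>z. z \<in> T \<Longrightarrow> c + L z \<in> S"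
  shows "C1_on (\<lambda>z. f (c + L z)) T"
proof -
  obtain D where D: "\<And>z. z \<in> S \<Longrightarrow> (f has_derivative blinfun_apply (D z)) (at z within S)"
    and cD: "continuous_on S D"
    using f unfolding C1_on_def by blast
  have 1: "((\<lambda>z. f (c + L z)) has_derivative blinfun_apply (D (c + L z) o\<^sub>L Blinfun L)) (at z within T)"
    if z: "z \<in> T" for z
  proof -
    have "((\<lambda>z. c + L z) has_derivative (\<lambda>z. 0 + L z)) (at z within T)"
      by (intro has_derivative_add has_derivative_const bounded_linear_imp_has_derivative L)
    then have "((\<lambda>z. c + L z) has_derivative L) (at z within T)" by simp
    moreover have "(f has_derivative D (c + L z)) (at (c + L z) within (\<lambda>z. c + L z) ` T)"
      by (rule has_derivative_subset[OF D]) (use T z in auto)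
    ultimately have "((\<lambda>z. f (c + L z)) has_derivative (\<lambda>y. D (c + L z) (L y))) (at z within T)"
      by (rule has_derivative_in_compose)
    moreover have "blinfun_apply (D (c + L z) o\<^sub>L Blinfun L) = (\<lambda>y. D (c + L z) (L y))"
      using L by (auto simp: bounded_linear_Blinfun_apply)
    ultimately show ?thesis by simp
  qed
  have "continuous_on T (\<lambda>z. D (c + L z))"
    by (rule continuous_on_compose2[OF cD _ image_subsetI[OF T]])
      (intro continuous_on_add continuous_on_const linear_continuous_on L)
  then have "continuous_on T (\<lambda>z. D (c + L z) o\<^sub>L Blinfun L)"
    by (intro bounded_bilinear.continuous_on[OF bounded_bilinear_blinfun_compose] continuous_intros)
  with 1 show ?thesis unfolding C1_on_def
    by (intro exI[of _ "\<lambda>z. D (c + L z) o\<^sub>L Blinfun L"]) auto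
qed

text \<open>Serves \<open>C2_on_affine\<close>: the chain rule composes the derivative with the
  fixed map \<open>Blinfun L\<close>, and this composition is a bounded linear operation on
  derivatives.\<close>

lemma C1_on_bounded_linear:
  assumes f: "C1_on f S" and K: "bounded_linear K"
  shows "C1_on (\<lambda>z. K (f z)) S"
proof -
  obtain D where D: "\<And>z. z \<in> S \<Longrightarrow> (f has_derivative blinfun_apply (D z)) (at z within S)"
    and cD: "continuous_on S D"
    using f unfolding C1_on_def by blast
  have "((\<lambda>z. K (f z)) has_derivative blinfun_apply (Blinfun K o\<^sub>L D z)) (at z within S)" if "z \<in> S" for z
  proof -
    have "blinfun_apply (Blinfun K o\<^sub>L D z) = (\<lambda>y. K (D z y))"
      using K by (auto simp: bounded_linear_Blinfun_apply)
    then show ?thesis using bounded_linear.has_derivative[OF K D[OF that]] by simp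
  qed
  moreover have "continuous_on S (\<lambda>z. Blinfun K o\<^sub>L D z)"
    by (intro bounded_bilinear.continuous_on[OF bounded_bilinear_blinfun_compose] continuous_intros cD)
  ultimately show ?thesis unfolding C1_on_def
    by (intro exI[of _ "\<lambda>z. Blinfun K o\<^sub>L D z"]) auto
qed

lemma C1_on_diff:
  assumes "C1_on f S" "C1_on g S"
  shows "C1_on (\<lambda>z. f z - g z) S"
proof -
  obtain D where D: "\<And>z. z \<in> S \<Longrightarrow> (f has_derivative blinfun_apply (D z)) (at z within S)"
    and cD: "continuous_on S D"
    using assms(1) unfolding C1_on_def by blast
  obtain E where E: "\<And>z. z \<in> S \<Longrightarrow> (g has_derivative blinfun_apply (E z)) (at z within S)"
    and cE: "continuous_on S E"
    using assms(2) unfolding C1_on_def by blast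
  have "((\<lambda>z. f z - g z) has_derivative blinfun_apply (D z - E z)) (at z within S)" if "z \<in> S" for z
    using has_derivative_diff[OF D[OF that] E[OF that]] by (simp add: minus_blinfun.rep_eq)
  then show ?thesis unfolding C1_on_def
    by (intro exI[of _ "\<lambda>z. D z - E z"]) (auto intro!: continuous_intros cD cE)
qed

lemma C2_on_affine:
  assumes f: "C2_on f S" and L: "bounded_linear L" and T: "\<And>z. z \<in> T \<Longrightarrow> c + L z \<in> S"
  shows "C2_on (\<lambda>z. f (c + L z)) T"
proof -
  obtain D where D: "\<And>z. z \<in> S \<Longrightarrow> (f has_derivative blinfun_apply (D z)) (at z within S)"
    and cD: "C1_on D S"
    using f unfolding C2_on_def by blast
  have 1: "((\<lambda>z. f (c + L z)) has_derivative blinfun_apply (D (c + L z) o\<^sub>L Blinfun L)) (at z within T)"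
    if z: "z \<in> T" for z
  proof -
    have "((\<lambda>z. c + L z) has_derivative (\<lambda>z. 0 + L z)) (at z within T)"
      by (intro has_derivative_add has_derivative_const bounded_linear_imp_has_derivative L)
    then have "((\<lambda>z. c + L z) has_derivative L) (at z within T)" by simp
    moreover have "(f has_derivative D (c + L z)) (at (c + L z) within (\<lambda>z. c + L z) ` T)"
      by (rule has_derivative_subset[OF D]) (use T z in auto)
    ultimately have "((\<lambda>z. f (c + L z)) has_derivative (\<lambda>y. D (c + L z) (L y))) (at z within T)"
      by (rule has_derivative_in_compose)
    moreover have "blinfun_apply (D (c + L z) o\<^sub>L Blinfun L) = (\<lambda>y. D (c + L z) (L y))"
      using L by (auto simp: bounded_linear_Blinfun_apply)
    ultimately show ?thesis by simp
  qed
  have "C1_on (\<lambda>z. D (c + L z) o\<^sub>L Blinfun L) T"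
    by (rule C1_on_bounded_linear[OF C1_on_affine[OF cD L T]])
      (auto intro: bounded_bilinear.bounded_linear_left[OF bounded_bilinear_blinfun_compose])
  with 1 show ?thesis unfolding C2_on_def
    by (intro exI[of _ "\<lambda>z. D (c + L z) o\<^sub>L Blinfun L"]) auto
qed

lemma C2_on_diff:
  assumes "C2_on f S" "C2_on g S"
  shows "C2_on (\<lambda>z. f z - g z) S"
proof -
  obtain D where D: "\<And>z. z \<in> S \<Longrightarrow> (f has_derivative blinfun_apply (D z)) (at z within S)"
    and cD: "C1_on D S"
    using assms(1) unfolding C2_on_def by blast
  obtain E where E: "\<And>z. z \<in> S \<Longrightarrow> (g has_derivative blinfun_apply (E z)) (at z within S)"
    and cE: "C1_on E S"
    using assms(2) unfolding C2_on_def by blast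
  have "((\<lambda>z. f z - g z) has_derivative blinfun_apply (D z - E z)) (at z within S)" if "z \<in> S" for z
    using has_derivative_diff[OF D[OF that] E[OF that]] by (simp add: minus_blinfun.rep_eq)
  then show ?thesis unfolding C2_on_def
    by (intro exI[of _ "\<lambda>z. D z - E z"]) (auto intro!: C1_on_diff cD cE)
qed

lemma C1_on_imp_continuous_on: "C1_on f S \<Longrightarrow> continuous_on S f"
  unfolding C1_on_def continuous_on_eq_continuous_within
  using has_derivative_continuous by blast

text \<open>Fixes the derivatives as named witnesses, on an open set so that they are unrestricted
  ones. In \<open>H z v u\<close> the direction \<open>v\<close> is the one in which
  \<open>D z u\<close> is differentiated.\<close>

definition derivs2 where
  "derivs2 S f D H \<longleftrightarrow> open S \<and>
    (\<forall>z\<in>S. (f has_derivative blinfun_apply (D z)) (at z)) \<and>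
    (\<forall>z\<in>S. (D has_derivative blinfun_apply (H z)) (at z)) \<and>
    continuous_on S H" for f :: "'a::real_normed_vector \<Rightarrow> real"

lemma C2_on_imp_derivs2:
  assumes "C2_on f S" "open S"
  obtains D H where "derivs2 S f D H"
proof -
  obtain D where D: "\<forall>z\<in>S. (f has_derivative blinfun_apply (D z)) (at z within S)"
    and cD: "C1_on D S"
    using assms unfolding C2_on_def by blast
  obtain H where H: "\<forall>z\<in>S. (D has_derivative blinfun_apply (H z)) (at z within S)"
    and cH: "continuous_on S H"
    using cD unfolding C1_on_def by blast
  show ?thesis
  proof (rule that[of D H], unfold derivs2_def, intro conjI ballI)
    fix z assume z: "z \<in> S"
    show "(f has_derivative blinfun_apply (D z)) (at z)" "(D has_derivative blinfun_apply (H z)) (at z)"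
      using D H z at_within_open[OF z assms(2)] by metis+
  qed (use assms cH in auto)
qed

lemma derivs2D:
  assumes "derivs2 S f D H"
  shows "open S" "z \<in> S \<Longrightarrow> (f has_derivative blinfun_apply (D z)) (at z)"
    "z \<in> S \<Longrightarrow> (D has_derivative blinfun_apply (H z)) (at z)"
    "continuous_on S H" "continuous_on S D" "continuous_on S f"
proof -
  show 1: "open S" "z \<in> S \<Longrightarrow> (f has_derivative blinfun_apply (D z)) (at z)"
    "z \<in> S \<Longrightarrow> (D has_derivative blinfun_apply (H z)) (at z)"
    "continuous_on S H" for z
    using assms unfolding derivs2_def by blast+
  show "continuous_on S D" "continuous_on S f"
    using has_derivative_continuous[OF 1(2)] has_derivative_continuous[OF 1(3)]
    by (simp_all add: continuous_at_imp_continuous_on)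
qed

text \<open>The two regularity classes come with unrelated derivative witnesses. On the open set
  \<open>Q\<close> both are full derivatives and agree by uniqueness, so one \<open>D\<close> can be
  differentiated inside and is continuous up to the boundary.\<close>

lemma C2_on_C1_on_derivs2:
  assumes C2: "C2_on f Q" and C1: "C1_on f K" and Q: "open Q" "Q \<subseteq> K"
  obtains D H where "derivs2 Q f D H" "continuous_on K D"
    "\<forall>z\<in>K. (f has_derivative blinfun_apply (D z)) (at z within K)"
proof -
  from C1[unfolded C1_on_def] obtain D
    where D: "\<forall>z\<in>K. (f has_derivative blinfun_apply (D z)) (at z within K)"
      and cD: "continuous_on K D"
    by (elim exE conjE)
  obtain D0 H where H: "derivs2 Q f D0 H"
    by (rule C2_on_imp_derivs2[OF C2 Q(1)])
  have DQ: "(f has_derivative blinfun_apply (D z)) (at z)" if "z \<in> Q" for z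
  proof -
    have "(f has_derivative blinfun_apply (D z)) (at z within Q)"
      by (rule has_derivative_subset[OF bspec[OF D] Q(2)]) (rule subsetD[OF Q(2) that])
    then show ?thesis by (simp only: at_within_open[OF that Q(1)])
  qed
  have D0: "D0 z = D z" if "z \<in> Q" for z
    using has_derivative_unique[OF derivs2D(2)[OF H that] DQ[OF that]]
    by (simp add: blinfun_apply_inject)
  have "derivs2 Q f D H"
    unfolding derivs2_def
  proof (intro conjI ballI DQ Q(1) derivs2D(4)[OF H])
    fix z assume z: "z \<in> Q"
    show "(D has_derivative blinfun_apply (H z)) (at z)"
      by (rule has_derivative_transform_within_open[OF derivs2D(3)[OF H z] Q(1) z D0])
  qed
  then show ?thesis using cD D by (rule that)
qed

lemma derivs2_diff:
  assumes f: "derivs2 S f D H" and g: "derivs2 S g E K"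
  shows "derivs2 S (\<lambda>z. f z - g z) (\<lambda>z. D z - E z) (\<lambda>z. H z - K z)"
  unfolding derivs2_def
proof (intro conjI ballI derivs2D(1)[OF f] continuous_on_diff derivs2D(4)[OF f] derivs2D(4)[OF g])
  fix z assume z: "z \<in> S"
  show "((\<lambda>z. f z - g z) has_derivative blinfun_apply (D z - E z)) (at z)"
    using has_derivative_diff[OF derivs2D(2)[OF f z] derivs2D(2)[OF g z]] by (simp add: minus_blinfun.rep_eq)
  show "((\<lambda>z. D z - E z) has_derivative blinfun_apply (H z - K z)) (at z)"
    using has_derivative_diff[OF derivs2D(3)[OF f z] derivs2D(3)[OF g z]] by (simp add: minus_blinfun.rep_eq)
qed

section \<open>Directional second derivatives and their symmetry\<close>

lemma has_real_derivative_along_line: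
  fixes f :: "'a::real_normed_vector \<Rightarrow> real"
  assumes "(f has_derivative F) (at (z + s *\<^sub>R v))"
  shows "((\<lambda>s. f (z + s *\<^sub>R v)) has_real_derivative F v) (at s)"
proof -
  have "((\<lambda>s. z + s *\<^sub>R v) has_derivative (\<lambda>h. h *\<^sub>R v)) (at s)"
    by (auto intro!: derivative_eq_intros)
  then have "((\<lambda>s. f (z + s *\<^sub>R v)) has_derivative (\<lambda>h. F (h *\<^sub>R v))) (at s)"
    using assms by (rule has_derivative_compose)
  moreover have "F (h *\<^sub>R v) = F v * h" for h
    using has_derivative_bounded_linear[OF assms] by (simp add: bounded_linear.linear linear_cmul)
  ultimately show ?thesis by (simp add: has_field_derivative_def)
qed

lemma derivs2_along_line:
  assumes "derivs2 S f D H" "z + s *\<^sub>R v \<in> S"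
  shows "((\<lambda>s. f (z + s *\<^sub>R v)) has_real_derivative D (z + s *\<^sub>R v) v) (at s)"
    and "((\<lambda>s. D (z + s *\<^sub>R v) u) has_real_derivative H (z + s *\<^sub>R v) v u) (at s)"
proof -
  show "((\<lambda>s. f (z + s *\<^sub>R v)) has_real_derivative D (z + s *\<^sub>R v) v) (at s)"
    by (rule has_real_derivative_along_line) (use derivs2D[OF assms(1)] assms(2) in auto)
  have "((\<lambda>z. D z u) has_derivative (\<lambda>h. H (z + s *\<^sub>R v) h u)) (at (z + s *\<^sub>R v))"
    by (rule bounded_linear.has_derivative[OF bounded_bilinear.bounded_linear_left[OF bounded_bilinear_blinfun_apply]])
      (use derivs2D[OF assms(1)] assms(2) in auto)
  from has_real_derivative_along_line[OF this]
  show "((\<lambda>s. D (z + s *\<^sub>R v) u) has_real_derivative H (z + s *\<^sub>R v) v u) (at s)" .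
qed

text \<open>Two mean value steps: the first in direction \<open>u\<close> for the increment of
  \<open>f\<close> by \<open>h v\<close>, the second in direction \<open>v\<close> for the increment
  of the derivative along \<open>u\<close>. The left side is symmetric in \<open>u\<close> and
  \<open>v\<close>, the right side is not visibly so.\<close>

lemma second_difference_mvt:
  fixes f :: "'a::real_normed_vector \<Rightarrow> real"
  assumes S: "derivs2 S f D H" "ball z r \<subseteq> S" and h: "h > 0" "h * (norm u + norm v) < r"
  shows "\<exists>\<xi>\<in>ball z r. f (z + h *\<^sub>R u + h *\<^sub>R v) - f (z + h *\<^sub>R u) - f (z + h *\<^sub>R v) + f z = h^2 * H \<xi> v u"
proof -
  have inb: "z + \<sigma> *\<^sub>R u + \<tau> *\<^sub>R v \<in> ball z r" if "0 \<le> \<sigma>" "\<sigma> \<le> h" "0 \<le> \<tau>" "\<tau> \<le> h" for \<sigma> \<tau>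
  proof -
    have "norm (\<sigma> *\<^sub>R u + \<tau> *\<^sub>R v) \<le> \<sigma> * norm u + \<tau> * norm v"
      using that by (intro order_trans[OF norm_triangle_ineq]) auto
    also have "\<dots> \<le> h * norm u + h * norm v"
      using that by (intro add_mono mult_right_mono) auto
    finally have "norm (\<sigma> *\<^sub>R u + \<tau> *\<^sub>R v) < r" using h by (simp add: algebra_simps)
    moreover have "dist z (z + \<sigma> *\<^sub>R u + \<tau> *\<^sub>R v) = norm (\<sigma> *\<^sub>R u + \<tau> *\<^sub>R v)"
      by (metis add.assoc add_diff_cancel_left' dist_commute dist_norm)
    ultimately show ?thesis by simp
  qed
  have "\<exists>\<sigma>>0. \<sigma> < h \<and>
      (f (z + h *\<^sub>R v + h *\<^sub>R u) - f (z + h *\<^sub>R u)) - (f (z + h *\<^sub>R v + 0 *\<^sub>R u) - f (z + 0 *\<^sub>R u))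
        = (h - 0) * (D (z + h *\<^sub>R v + \<sigma> *\<^sub>R u) u - D (z + \<sigma> *\<^sub>R u) u)"
  proof (rule MVT2[OF h(1)])
    fix s assume s: "0 \<le> s" "s \<le> h"
    have "z + h *\<^sub>R v + s *\<^sub>R u \<in> S" "z + s *\<^sub>R u \<in> S"
      using inb[of s h] inb[of s 0] s h S(2) by (auto simp: algebra_simps)
    then show "((\<lambda>s. f (z + h *\<^sub>R v + s *\<^sub>R u) - f (z + s *\<^sub>R u)) has_real_derivative
        D (z + h *\<^sub>R v + s *\<^sub>R u) u - D (z + s *\<^sub>R u) u) (at s)"
      by (intro DERIV_diff derivs2_along_line[OF S(1)])
  qed
  then obtain \<sigma> where \<sigma>: "0 < \<sigma>" "\<sigma> < h" and eq1:
      "f (z + h *\<^sub>R v + h *\<^sub>R u) - f (z + h *\<^sub>R u) - f (z + h *\<^sub>R v) + f z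
        = h * (D (z + h *\<^sub>R v + \<sigma> *\<^sub>R u) u - D (z + \<sigma> *\<^sub>R u) u)"
    by auto
  have "\<exists>\<tau>>0. \<tau> < h \<and>
      D (z + \<sigma> *\<^sub>R u + h *\<^sub>R v) u - D (z + \<sigma> *\<^sub>R u + 0 *\<^sub>R v) u
        = (h - 0) * H (z + \<sigma> *\<^sub>R u + \<tau> *\<^sub>R v) v u"
  proof (rule MVT2[OF h(1)])
    fix s assume s: "0 \<le> s" "s \<le> h"
    have "z + \<sigma> *\<^sub>R u + s *\<^sub>R v \<in> S"
      using inb[of \<sigma> s] s \<sigma> S(2) by auto
    then show "((\<lambda>s. D (z + \<sigma> *\<^sub>R u + s *\<^sub>R v) u) has_real_derivative
        H (z + \<sigma> *\<^sub>R u + s *\<^sub>R v) v u) (at s)"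
      by (rule derivs2_along_line[OF S(1)])
  qed
  then obtain \<tau> where \<tau>: "0 < \<tau>" "\<tau> < h" and eq2:
      "D (z + \<sigma> *\<^sub>R u + h *\<^sub>R v) u - D (z + \<sigma> *\<^sub>R u) u = h * H (z + \<sigma> *\<^sub>R u + \<tau> *\<^sub>R v) v u"
    by auto
  show ?thesis
  proof
    show "z + \<sigma> *\<^sub>R u + \<tau> *\<^sub>R v \<in> ball z r" using inb \<sigma> \<tau> by simp
    show "f (z + h *\<^sub>R u + h *\<^sub>R v) - f (z + h *\<^sub>R u) - f (z + h *\<^sub>R v) + f z
        = h^2 * H (z + \<sigma> *\<^sub>R u + \<tau> *\<^sub>R v) v u"
      using eq1 eq2 by (simp add: power2_eq_square add_ac)
  qed
qed

text \<open>The symmetric second difference equals both \<open>h^2 * H \<xi> v u\<close> and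
  \<open>h^2 * H \<zeta> u v\<close> with points near \<open>z\<close>; continuity of
  \<open>H\<close> at \<open>z\<close> then excludes a gap between the two orders.\<close>

lemma derivs2_symmetric:
  fixes f :: "'a::real_normed_vector \<Rightarrow> real"
  assumes S: "derivs2 S f D H" and z: "z \<in> S"
  shows "H z u v = H z v u"
proof (rule ccontr)
  assume "H z u v \<noteq> H z v u"
  then have \<eta>: "\<bar>H z u v - H z v u\<bar> / 2 > 0" (is "?\<eta> > 0") by simp
  note op = derivs2D(1)[OF S] and cH = derivs2D(4)[OF S]
  have "isCont H z" using cH op z continuous_on_eq_continuous_at by blast
  then have cH: "isCont (\<lambda>z. H z x y) z" for x y
    by (intro continuous_intros)
  obtain r1 r2 where r: "r1 > 0" "r2 > 0"
    "\<And>x. dist x z < r1 \<Longrightarrow> dist (H x v u) (H z v u) < ?\<eta>" "\<And>x. dist x z < r2 \<Longrightarrow> dist (H x u v) (H z u v) < ?\<eta>"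
    using cH[of v u] cH[of u v] \<eta> unfolding continuous_at_eps_delta by metis
  obtain r3 where r3: "r3 > 0" "ball z r3 \<subseteq> S" using op z open_contains_ball by blast
  define r where "r = min r1 (min r2 r3)"
  have rp: "r > 0" "ball z r \<subseteq> S" using r r3 by (auto simp: r_def)
  \<comment> \<open>The summand 1 keeps the denominator positive when \<open>u\<close> and
    \<open>v\<close> are both zero.\<close>
  define h where "h = r / (2 * (norm u + norm v + 1))"
  have pos: "norm u + norm v + 1 > 0" by (simp add: add_nonneg_pos)
  then have h: "h > 0" using rp by (simp add: h_def)
  have "h * (norm u + norm v) \<le> h * (norm u + norm v + 1)" using h by simp
  also have "\<dots> = r / 2" using pos unfolding h_def by (auto simp: divide_simps)
  finally have h2: "h * (norm u + norm v) < r" using rp by simp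
  obtain \<xi> where x: "\<xi> \<in> ball z r"
      "f (z + h *\<^sub>R u + h *\<^sub>R v) - f (z + h *\<^sub>R u) - f (z + h *\<^sub>R v) + f z = h^2 * H \<xi> v u"
    using second_difference_mvt[OF S rp(2) h h2] by blast
  obtain \<zeta> where y: "\<zeta> \<in> ball z r"
      "f (z + h *\<^sub>R v + h *\<^sub>R u) - f (z + h *\<^sub>R v) - f (z + h *\<^sub>R u) + f z = h^2 * H \<zeta> u v"
    using second_difference_mvt[OF S rp(2) h, of v u] h2 by (auto simp: add.commute)
  have "f (z + h *\<^sub>R v + h *\<^sub>R u) = f (z + h *\<^sub>R u + h *\<^sub>R v)" by (simp add: add_ac)
  with x(2) y(2) have "h^2 * H \<xi> v u = h^2 * H \<zeta> u v" by linarith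
  then have "H \<xi> v u = H \<zeta> u v" using h by simp
  moreover have "dist (H \<xi> v u) (H z v u) < ?\<eta>" "dist (H \<zeta> u v) (H z u v) < ?\<eta>"
    using r x(1) y(1) by (auto simp: r_def dist_commute)
  ultimately show False by (simp add: dist_real_def) argo
qed

text \<open>An iterated \<open>deriv\<close> at \<open>s\<close> depends on the first derivative in
  a neighbourhood of \<open>s\<close>; the open preimage of \<open>S\<close> under the line provides
  one.\<close>

lemma derivs2_deriv2:
  assumes S: "derivs2 S f D H" and z: "z + s *\<^sub>R v \<in> S"
  shows "(deriv ^^ 2) (\<lambda>s. f (z + s *\<^sub>R v)) s = H (z + s *\<^sub>R v) v v"
proof -
  have op: "open ((\<lambda>s. z + s *\<^sub>R v) -` S)"
    by (rule open_vimage[OF derivs2D(1)[OF S]]) (intro continuous_intros)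
  have "deriv (\<lambda>s. f (z + s *\<^sub>R v)) s' = D (z + s' *\<^sub>R v) v" if "s' \<in> (\<lambda>s. z + s *\<^sub>R v) -` S" for s'
    using that by (intro DERIV_imp_deriv derivs2_along_line[OF S]) auto
  then have "\<forall>\<^sub>F s' in nhds s. deriv (\<lambda>s. f (z + s *\<^sub>R v)) s' = D (z + s' *\<^sub>R v) v"
    using op z by (intro eventually_nhds[THEN iffD2] exI[of _ "(\<lambda>s. z + s *\<^sub>R v) -` S"]) auto
  then have "deriv (deriv (\<lambda>s. f (z + s *\<^sub>R v))) s = deriv (\<lambda>s. D (z + s *\<^sub>R v) v) s"
    by (rule deriv_cong_ev) simp
  also have "\<dots> = H (z + s *\<^sub>R v) v v"
    by (intro DERIV_imp_deriv derivs2_along_line[OF S] z)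
  finally show ?thesis by (simp add: numeral_2_eq_2)
qed

text \<open>Trades the iterated \<open>deriv\<close> of the definition for values of
  \<open>H\<close>, which is continuous in space and time jointly.\<close>

lemma wave_eq_at_derivs2:
  fixes v :: "'a::euclidean_space \<Rightarrow> real \<Rightarrow> real"
  assumes S: "derivs2 S (\<lambda>(x, t). v x t) D H" and z: "(x, t) \<in> S"
  shows "wave_eq_at v x t \<longleftrightarrow> H (x, t) (0, 1) (0, 1) = (\<Sum>i\<in>Basis. H (x, t) (i, 0) (i, 0))"
proof -
  have "(deriv ^^ 2) (\<lambda>s. v x s) t = H (x, t) (0, 1) (0, 1)"
    using derivs2_deriv2[OF S, of "(x, 0)" t "(0, 1)"] z by simp
  moreover have "(deriv ^^ 2) (\<lambda>s. v (x + s *\<^sub>R i) t) 0 = H (x, t) (i, 0) (i, 0)" for i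
    using derivs2_deriv2[OF S, of "(x, t)" 0 "(i, 0)"] z by simp
  ultimately show ?thesis by (simp add: wave_eq_at_def laplacian_def)
qed

section \<open>A cutoff function\<close>

text \<open>A quadratic spline: its derivative is the hat function on [0, 2] with peak 2 at 1. The
  energy argument differentiates the cutoff once, so class C1 suffices.\<close>

definition smooth_step :: "real \<Rightarrow> real" where
  "smooth_step s = (max 0 s)^2 - 2 * (max 0 (s - 1))^2 + (max 0 (s - 2))^2"

definition smooth_step' :: "real \<Rightarrow> real" where
  "smooth_step' s = 2 * max 0 s - 4 * max 0 (s - 1) + 2 * max 0 (s - 2)"

text \<open>An exponent of at least 2 flattens the corner of \<open>max 0 s\<close> at 0. Both the
  cutoff and the profile \<open>bump\<close> are built from such powers.\<close>

lemma has_real_derivative_pos_part_power: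
  "((\<lambda>s::real. (max 0 s) ^ (k + 2)) has_real_derivative real (k + 2) * (max 0 s) ^ (k + 1)) (at s)"
proof -
  consider "s < 0" | "s > 0" | "s = 0" by linarith
  then show ?thesis
  proof cases
    case 1
    have "((\<lambda>s::real. 0) has_real_derivative 0) (at s)" by simp
    then have "((\<lambda>s::real. (max 0 s) ^ (k + 2)) has_real_derivative 0) (at s)"
      by (rule has_field_derivative_transform_within_open[of _ _ _ "{..<0}"]) (use 1 in \<open>auto simp: max_def\<close>)
    then show ?thesis using 1 by (simp add: max_def)
  next
    case 2
    have "((\<lambda>s::real. s ^ (k + 2)) has_real_derivative real (k + 2) * s ^ (k + 1)) (at s)"
      by (rule derivative_eq_intros refl)+ simp
    then have "((\<lambda>s::real. (max 0 s) ^ (k + 2)) has_real_derivative real (k + 2) * s ^ (k + 1)) (at s)"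
      by (rule has_field_derivative_transform_within_open[of _ _ _ "{0<..}"]) (use 2 in \<open>auto simp: max_def\<close>)
    then show ?thesis using 2 by (simp add: max_def)
  next
    case 3
    \<comment> \<open>At the corner the difference quotient is at most the next lower power, which
      still tends to 0.\<close>
    have "((\<lambda>h::real. (max 0 h) ^ (k + 2) / h) \<longlongrightarrow> 0) (at 0)"
    proof (rule Lim_null_comparison)
      show "\<forall>\<^sub>F h::real in at 0. norm ((max 0 h) ^ (k + 2) / h) \<le> (max 0 h) ^ (k + 1)"
        by (auto simp: max_def intro!: always_eventually)
      have "((\<lambda>h::real. (max 0 h) ^ (k + 1)) \<longlongrightarrow> (max 0 0) ^ (k + 1)) (at 0)"
        by (intro tendsto_intros)
      then show "((\<lambda>h::real. (max 0 h) ^ (k + 1)) \<longlongrightarrow> 0) (at 0)" by simp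
    qed
    then show ?thesis using 3 by (simp add: has_field_derivative_iff)
  qed
qed

lemma smooth_step_deriv: "(smooth_step has_real_derivative smooth_step' s) (at s)"
proof -
  have d: "((\<lambda>s. (max 0 (s - c))^2) has_real_derivative 2 * max 0 (s - c)) (at s)" for c
    using DERIV_shift[of "\<lambda>s. (max 0 s)^2" "2 * max 0 (s - c)" s "- c"]
      has_real_derivative_pos_part_power[of 0 "s - c"] by (simp add: numeral_2_eq_2)
  have "((\<lambda>s. (max 0 (s - 0))^2 - 2 * (max 0 (s - 1))^2 + (max 0 (s - 2))^2) has_real_derivative
     2 * max 0 (s - 0) - 2 * (2 * max 0 (s - 1)) + 2 * max 0 (s - 2)) (at s)"
    by (intro DERIV_add DERIV_diff DERIV_cmult d)
  then show ?thesis unfolding smooth_step_def[abs_def] smooth_step'_def by simp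
qed

lemma smooth_step_simps: "s \<le> 0 \<Longrightarrow> smooth_step s = 0" "s \<ge> 2 \<Longrightarrow> smooth_step s = 2"
  by (auto simp: smooth_step_def max_def power2_eq_square algebra_simps)

lemma smooth_step'_bounds: "0 \<le> smooth_step' s" "smooth_step' s \<le> 2" "s \<le> 0 \<Longrightarrow> smooth_step' s = 0" "s \<ge> 2 \<Longrightarrow> smooth_step' s = 0"
  by (auto simp: smooth_step'_def max_def)

lemma smooth_step_bounds: "0 \<le> smooth_step s" "smooth_step s \<le> 2"
proof -
  have mono: "smooth_step a \<le> smooth_step b" if "a \<le> b" for a b
    by (rule DERIV_nonneg_imp_nondecreasing[OF that]) (use smooth_step_deriv smooth_step'_bounds(1) in blast)
  show "0 \<le> smooth_step s" using mono[of "min 0 s" s] by (simp add: smooth_step_simps)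
  show "smooth_step s \<le> 2" using mono[of s "max 2 s"] by (simp add: smooth_step_simps)
qed

text \<open>Written with \<open>x \<bullet> x\<close> rather than the norm, to stay differentiable
  at the origin. The shift by 1 makes it vanish already where
  \<open>1 - x \<bullet> x \<le> \<delta>\<close>, so its support keeps a distance from the sphere;
  it equals 2 from \<open>3 * \<delta>\<close> on.\<close>

definition ball_cut :: "real \<Rightarrow> 'a::real_inner \<Rightarrow> real" where
  "ball_cut \<delta> x = smooth_step ((1 - x \<bullet> x) / \<delta> - 1)"

definition ball_cut' :: "real \<Rightarrow> 'a::real_inner \<Rightarrow> 'a \<Rightarrow> real" where
  "ball_cut' \<delta> i x = smooth_step' ((1 - x \<bullet> x) / \<delta> - 1) * (- 2 * (x \<bullet> i) / \<delta>)"

lemma ball_cut_deriv: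
  "((\<lambda>s. ball_cut \<delta> (x + s *\<^sub>R i)) has_real_derivative ball_cut' \<delta> i x) (at 0)"
proof -
  have "((\<lambda>s. (1 - (x + s *\<^sub>R i) \<bullet> (x + s *\<^sub>R i)) / \<delta> - 1) has_real_derivative (- 2 * (x \<bullet> i) / \<delta>)) (at 0)"
    unfolding inner_add_left inner_add_right inner_scaleR_left inner_scaleR_right
    by (auto intro!: derivative_eq_intros simp: inner_commute divide_inverse algebra_simps)
  from DERIV_chain2[OF smooth_step_deriv this] show ?thesis
    unfolding ball_cut_def ball_cut'_def by simp
qed

lemma continuous_on_smooth_step: "continuous_on S smooth_step"
  by (meson smooth_step_deriv DERIV_isCont continuous_at_imp_continuous_on)

lemma continuous_on_ball_cut: "continuous_on S (ball_cut \<delta>)"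
  unfolding ball_cut_def[abs_def] divide_inverse
  by (rule continuous_on_compose2[OF continuous_on_smooth_step[of UNIV]]) (auto intro!: continuous_intros)

lemma continuous_on_ball_cut': "continuous_on S (ball_cut' \<delta> i)"
  unfolding ball_cut'_def[abs_def] smooth_step'_def divide_inverse
  by (intro continuous_intros)

lemma ball_cut_bounds:
  assumes "\<delta> > 0"
  shows "0 \<le> ball_cut \<delta> x" "ball_cut \<delta> x \<le> 2" "1 - x \<bullet> x \<le> \<delta> \<Longrightarrow> ball_cut \<delta> x = 0"
    "1 - x \<bullet> x \<ge> 3 * \<delta> \<Longrightarrow> ball_cut \<delta> x = 2"
    "1 - x \<bullet> x \<le> \<delta> \<Longrightarrow> ball_cut' \<delta> i x = 0"
    "1 - x \<bullet> x \<ge> 3 * \<delta> \<Longrightarrow> ball_cut' \<delta> i x = 0"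
    "norm i = 1 \<Longrightarrow> \<bar>ball_cut' \<delta> i x\<bar> \<le> 4 / \<delta>"
proof -
  show "0 \<le> ball_cut \<delta> x" "ball_cut \<delta> x \<le> 2" by (auto simp: ball_cut_def smooth_step_bounds)
  show 1: "1 - x \<bullet> x \<le> \<delta> \<Longrightarrow> ball_cut \<delta> x = 0" "1 - x \<bullet> x \<le> \<delta> \<Longrightarrow> ball_cut' \<delta> i x = 0"
    using assms by (auto simp: ball_cut_def ball_cut'_def intro!: smooth_step_simps smooth_step'_bounds(3))
  show "1 - x \<bullet> x \<ge> 3 * \<delta> \<Longrightarrow> ball_cut \<delta> x = 2" "1 - x \<bullet> x \<ge> 3 * \<delta> \<Longrightarrow> ball_cut' \<delta> i x = 0"
    using assms by (auto simp: ball_cut_def ball_cut'_def field_simps intro!: smooth_step_simps smooth_step'_bounds(4))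
  show "\<bar>ball_cut' \<delta> i x\<bar> \<le> 4 / \<delta>" if i: "norm i = 1"
  \<comment> \<open>The 4 is the bound 2 for \<open>smooth_step'\<close> times the factor 2 from
    differentiating \<open>x \<bullet> x\<close>. Outside the ball, where
    \<open>x \<bullet> i\<close> is not bounded by 1, the gradient vanishes.\<close>
  proof (cases "norm x \<le> 1")
    case True
    have "\<bar>x \<bullet> i\<bar> \<le> 1" using Cauchy_Schwarz_ineq2[of x i] i True by simp
    then have "\<bar>smooth_step' ((1 - x \<bullet> x) / \<delta> - 1)\<bar> * (2 * \<bar>x \<bullet> i\<bar>) \<le> 2 * (2 * 1)"
      using smooth_step'_bounds(1,2)[of "(1 - x \<bullet> x) / \<delta> - 1"] by (intro mult_mono) auto
    then show ?thesis
      using assms by (simp add: ball_cut'_def abs_mult divide_simps)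
  next
    case False
    then have "x \<bullet> x > 1" by (simp add: dot_square_norm one_less_power)
    then show ?thesis using 1(2) assms by simp
  qed
qed

text \<open>Nothing is known about \<open>G\<close> outside \<open>S\<close>; the zero of
  \<open>\<phi>\<close> there makes its values irrelevant, and the product becomes an indicator
  times a continuous function.\<close>

lemma borel_measurable_cutoff_mult:
  fixes \<phi> G :: "'a::euclidean_space \<Rightarrow> real"
  assumes "continuous_on S \<phi>" "continuous_on S G" "S \<in> sets borel" "\<And>x. x \<notin> S \<Longrightarrow> \<phi> x = 0"
  shows "(\<lambda>x. \<phi> x * G x) \<in> borel_measurable borel"
proof -
  have "(\<lambda>x. indicator S x *\<^sub>R (\<phi> x * G x)) \<in> borel_measurable borel"
    using assms by (intro borel_measurable_continuous_on_indicator continuous_intros)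
  moreover have "(\<lambda>x. indicator S x *\<^sub>R (\<phi> x * G x)) = (\<lambda>x. \<phi> x * G x)"
    using assms(4) by (fastforce simp: indicator_def)
  ultimately show ?thesis by simp
qed

text \<open>A volume linear in \<open>\<delta>\<close> is what cancels the gradient bound
  \<open>4 / \<delta>\<close> of the cutoff.\<close>

lemma shell_measure_le:
  fixes \<delta> :: real
  assumes "0 < \<delta>" "3 * \<delta> \<le> 1"
  shows "measure lborel (cball 0 1 - ball (0::'a::euclidean_space) (sqrt (1 - 3 * \<delta>)))
     \<le> unit_ball_vol (DIM('a)) * (DIM('a) * (3 * \<delta>))"
proof -
  define r where "r = sqrt (1 - 3 * \<delta>)"
  have r: "0 \<le> r" "r \<le> 1" "r^2 = 1 - 3 * \<delta>" using assms by (auto simp: r_def)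
  have "measure lborel (cball 0 1 - ball (0::'a) r) = measure lborel (cball (0::'a) 1) - measure lborel (ball (0::'a) r)"
    using r emeasure_lborel_cball_finite[of "0::'a" 1]
    by (intro measure_Diff) (auto simp: infinity_ennreal_def)
  also have "\<dots> = unit_ball_vol (DIM('a)) * (1 - r ^ DIM('a))"
    using r by (simp add: content_cball content_ball algebra_simps)
  also have "\<dots> \<le> unit_ball_vol (DIM('a)) * (DIM('a) * (3 * \<delta>))"
  proof (rule mult_left_mono)
    \<comment> \<open>Bernoulli's inequality linearises the power; then \<open>r^2 \<le> r\<close>
      on [0, 1] removes the square root hidden in \<open>r\<close>.\<close>
    have "1 - r ^ DIM('a) \<le> DIM('a) * (1 - r)"
      using Bernoulli_inequality[of "r - 1" "DIM('a)"] r by (simp add: algebra_simps)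
    also have "\<dots> \<le> DIM('a) * (1 - r^2)"
      using r mult_left_le_one_le[of r r] by (intro mult_left_mono diff_left_mono) (auto simp: power2_eq_square)
    finally show "1 - r ^ DIM('a) \<le> DIM('a) * (3 * \<delta>)" using r by simp
  qed simp
  finally show ?thesis by (simp add: r_def)
qed

section \<open>Energy estimate in the ball\<close>

lemma unit_directions:
  "norm (0::'a::euclidean_space, 1::real) = 1" "i \<in> Basis \<Longrightarrow> norm (i::'a, 0::real) = 1"
  by (auto simp: norm_Pair)

text \<open>\<open>D\<close> is controlled on the closed cylinder, \<open>H\<close> on the open one
  only. The condition \<open>init\<close> kills the whole gradient at time 0, spatial part included,
  so that the energy starts at 0.\<close>

locale ball_wave =
  fixes f :: "'a::euclidean_space \<times> real \<Rightarrow> real"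
    and D :: "'a \<times> real \<Rightarrow> ('a \<times> real) \<Rightarrow>\<^sub>L real"
    and H :: "'a \<times> real \<Rightarrow> ('a \<times> real) \<Rightarrow>\<^sub>L ('a \<times> real) \<Rightarrow>\<^sub>L real"
    and T M :: real
  assumes T: "T > 0"
    and derivs: "derivs2 (ball 0 1 \<times> {0<..<T}) f D H"
    and cont: "continuous_on (cball 0 1 \<times> {0..T}) D"
    and M: "\<And>z. z \<in> cball 0 1 \<times> {0..T} \<Longrightarrow> norm (D z) \<le> M"
    and wave: "\<And>z. z \<in> ball 0 1 \<times> {0<..<T} \<Longrightarrow> H z (0, 1) (0, 1) = (\<Sum>i\<in>Basis. H z (i, 0) (i, 0))"
    and init: "\<And>x. x \<in> ball 0 1 \<Longrightarrow> D (x, 0) = 0"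
begin

lemma M_nonneg: "M \<ge> 0"
  by (rule order_trans[OF norm_ge_zero M[of "(0, 0)"]]) (use T in auto)

lemma D_bound:
  assumes "x \<in> cball 0 1" "0 \<le> t" "t \<le> T" "norm v = 1"
  shows "\<bar>D (x, t) v\<bar> \<le> M"
  using norm_blinfun[of "D (x, t)" v] M[of "(x, t)"] assms by simp

lemma continuous_D: "0 \<le> t \<Longrightarrow> t \<le> T \<Longrightarrow> continuous_on (cball 0 1) (\<lambda>x. D (x, t) v)"
  by (intro continuous_intros continuous_on_compose2[OF cont]) auto

lemma continuous_D_ball: "0 \<le> t \<Longrightarrow> t \<le> T \<Longrightarrow> continuous_on (ball 0 1) (\<lambda>x. D (x, t) v)"
  by (rule continuous_on_subset[OF continuous_D ball_subset_cball])

lemma continuous_H: "0 < t \<Longrightarrow> t < T \<Longrightarrow> continuous_on (ball 0 1) (\<lambda>x. H (x, t) u v)"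
  by (intro continuous_intros continuous_on_compose2[OF derivs2D(4)[OF derivs]]) auto

lemma in_ball_if_cutoff: "\<delta> > 0 \<Longrightarrow> 1 - x \<bullet> x > \<delta> \<Longrightarrow> (x::'a) \<in> ball 0 1"
proof -
  assume "\<delta> > 0" "1 - x \<bullet> x > \<delta>"
  then have "(norm x)\<^sup>2 < 1\<^sup>2" by (simp add: power2_norm_eq_inner)
  then have "norm x < 1" by (rule power_less_imp_less_base) simp
  then show ?thesis by simp
qed

text \<open>On the support of the cutoff, and for times away from both ends, one moves in a compact
  part of the open cylinder, where the continuous \<open>H\<close> is bounded.\<close>

lemma H_bound:
  assumes \<delta>: "\<delta> > 0" and t: "0 < t1" "t2 < T"
  obtains B where "B \<ge> 0"
    "\<And>x t u v. 1 - x \<bullet> x > \<delta> \<Longrightarrow> t1 \<le> t \<Longrightarrow> t \<le> t2 \<Longrightarrow> norm u = 1 \<Longrightarrow> norm v = 1 \<Longrightarrow> \<bar>H (x, t) u v\<bar> \<le> B"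
proof -
  let ?A = "{x::'a. 1 - x \<bullet> x \<ge> \<delta>}"
  have sub: "?A \<subseteq> ball 0 1"
    \<comment> \<open>Halving \<open>\<delta>\<close> turns the weak inequality that defines the
      closed set into the strict one required.\<close>
    using in_ball_if_cutoff[of "\<delta> / 2"] \<delta> by force
  have "closed ?A" by (intro closed_Collect_le continuous_intros)
  moreover have "bounded ?A" using sub bounded_ball bounded_subset by blast
  ultimately have "compact (?A \<times> {t1..t2})"
    by (intro compact_Times) (auto simp: compact_eq_bounded_closed)
  moreover have "continuous_on (?A \<times> {t1..t2}) H"
    by (rule continuous_on_subset[OF derivs2D(4)[OF derivs]]) (use sub t in force)
  ultimately have "bounded (H ` (?A \<times> {t1..t2}))"
    by (intro compact_imp_bounded compact_continuous_image)
  then obtain B where B: "B > 0" "\<And>z. z \<in> ?A \<times> {t1..t2} \<Longrightarrow> norm (H z) \<le> B"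
    unfolding bounded_pos by blast
  show ?thesis
  proof (rule that[of B])
    fix x :: "'a" and t and u v :: "'a \<times> real" assume x: "1 - x \<bullet> x > \<delta>" "t1 \<le> t" "t \<le> t2" and uv: "norm u = 1" "norm v = 1"
    have "\<bar>H (x, t) u v\<bar> \<le> norm (H (x, t) u)" using norm_blinfun[of "H (x, t) u" v] uv by simp
    also have "\<dots> \<le> norm (H (x, t))" using norm_blinfun[of "H (x, t)" u] uv by simp
    also have "\<dots> \<le> B" using x by (intro B) auto
    finally show "\<bar>H (x, t) u v\<bar> \<le> B" .
  qed (use B in simp)
qed

text \<open>The derivative in direction \<open>i\<close> of the \<open>i\<close>-th component of the
  field \<phi> w_t \<nabla>w, where \<phi> is \<open>ball_cut \<delta>\<close>.\<close>

definition flux_div :: "real \<Rightarrow> real \<Rightarrow> 'a \<Rightarrow> 'a \<Rightarrow> real" where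
  "flux_div \<delta> t i x = ball_cut' \<delta> i x * (D (x, t) (0, 1) * D (x, t) (i, 0))
     + ball_cut \<delta> x * (H (x, t) (i, 0) (0, 1) * D (x, t) (i, 0) + D (x, t) (0, 1) * H (x, t) (i, 0) (i, 0))"

text \<open>The field is supported strictly inside the ball, so its extension by zero is
  differentiable everywhere along \<open>i\<close> and translation invariance applies.\<close>

lemma flux_div_integral:
  assumes \<delta>: "\<delta> > 0" and t: "0 < t" "t < T" and i: "i \<in> Basis"
  shows "integrable lborel (flux_div \<delta> t i)" "(\<integral>x. flux_div \<delta> t i x \<partial>lborel) = 0"
proof -
  obtain B where B: "B \<ge> 0"
    "\<And>x u v. 1 - x \<bullet> x > \<delta> \<Longrightarrow> norm u = 1 \<Longrightarrow> norm v = 1 \<Longrightarrow> \<bar>H (x, t) u v\<bar> \<le> B"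
    using H_bound[OF \<delta> t(1) t(2)] t by (metis order_refl)
  have out: "1 - x \<bullet> x \<le> \<delta>" if "x \<notin> ball 0 1" for x :: 'a
    using that in_ball_if_cutoff[OF \<delta>, of x] by force
  have meas: "flux_div \<delta> t i \<in> borel_measurable borel"
    unfolding flux_div_def[abs_def]
    using t by (intro borel_measurable_add borel_measurable_cutoff_mult[where S = "ball 0 1"]
        continuous_on_ball_cut continuous_on_ball_cut' continuous_on_mult continuous_on_add continuous_H
        continuous_D_ball ball_cut_bounds[OF \<delta>] out) auto
  define C where "C = 4 / \<delta> * (M * M) + 2 * (B * M + M * B)"
  have M0: "M \<ge> 0" by (rule M_nonneg)
  have C0: "C \<ge> 0" using M0 B \<delta> by (simp add: C_def)
  have bd: "\<bar>flux_div \<delta> t i x\<bar> \<le> C" for x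
  proof (cases "1 - x \<bullet> x \<le> \<delta>")
    case True
    then show ?thesis using C0 by (simp add: flux_div_def ball_cut_bounds[OF \<delta>])
  next
    case False
    then have x: "x \<in> cball 0 1" using out by force
    note bs = unit_directions(1) unit_directions(2)[OF i]
    have D: "\<bar>D (x, t) (0, 1)\<bar> \<le> M" "\<bar>D (x, t) (i, 0)\<bar> \<le> M"
      using D_bound[OF x] t bs by auto
    have H: "\<bar>H (x, t) (i, 0) (0, 1)\<bar> \<le> B" "\<bar>H (x, t) (i, 0) (i, 0)\<bar> \<le> B"
      using B(2) False bs by auto
    have "\<bar>ball_cut' \<delta> i x\<bar> \<le> 4 / \<delta>" "\<bar>ball_cut \<delta> x\<bar> \<le> 2"
      using ball_cut_bounds(7)[OF \<delta> norm_Basis[OF i]] ball_cut_bounds(1,2)[OF \<delta>, of x] by simp_all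
    then have "\<bar>flux_div \<delta> t i x\<bar> \<le> \<bar>ball_cut' \<delta> i x\<bar> * (\<bar>D (x, t) (0, 1)\<bar> * \<bar>D (x, t) (i, 0)\<bar>)
      + \<bar>ball_cut \<delta> x\<bar> * (\<bar>H (x, t) (i, 0) (0, 1)\<bar> * \<bar>D (x, t) (i, 0)\<bar> + \<bar>D (x, t) (0, 1)\<bar> * \<bar>H (x, t) (i, 0) (i, 0)\<bar>)"
      unfolding flux_div_def abs_mult[symmetric]
      by (intro order_trans[OF abs_triangle_ineq] add_mono)
        (auto simp: abs_mult intro!: mult_left_mono order_trans[OF abs_triangle_ineq])
    also have "\<dots> \<le> C"
      unfolding C_def
      using D H B(1) M0 \<open>\<bar>ball_cut' \<delta> i x\<bar> \<le> 4 / \<delta>\<close> \<open>\<bar>ball_cut \<delta> x\<bar> \<le> 2\<close> \<delta>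
      by (intro add_mono mult_mono) auto
    finally show ?thesis .
  qed
  have "norm x > 1 \<Longrightarrow> flux_div \<delta> t i x = 0" for x
    using out[of x] by (simp add: flux_div_def ball_cut_bounds[OF \<delta>])
  then show "integrable lborel (flux_div \<delta> t i)"
    by (intro integrable_bounded_support[where C = C and R = 1] meas bd)
  define V where "V x = ball_cut \<delta> x * (D (x, t) (0, 1) * D (x, t) (i, 0))" for x
  show "(\<integral>x. flux_div \<delta> t i x \<partial>lborel) = 0"
  proof (rule integral_directional_derivative_eq_0[where V = V and N = "{}" and e = i and R = 1])
    show "V \<in> borel_measurable borel"
      unfolding V_def[abs_def]
      using t by (intro borel_measurable_cutoff_mult[where S = "ball 0 1"]
        continuous_on_ball_cut continuous_on_add continuous_on_sum continuous_on_power continuous_on_mult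
        continuous_D_ball ball_cut_bounds[OF \<delta>] out) auto
    show "\<bar>V x\<bar> \<le> 2 * (M * M)" for x
    proof (cases "x \<in> ball 0 1")
      case True
      then have x: "x \<in> cball 0 1" by simp
      have D: "\<bar>D (x, t) (0, 1)\<bar> \<le> M" "\<bar>D (x, t) (i, 0)\<bar> \<le> M"
        using D_bound[OF x] t unit_directions i by auto
      then show ?thesis unfolding V_def abs_mult
        using ball_cut_bounds(1,2)[OF \<delta>, of x] M0 by (intro mult_mono) auto
    next
      case False
      then show ?thesis using M0 by (simp add: V_def ball_cut_bounds[OF \<delta>] out)
    qed
    show "V x = 0" if "1 < norm x" for x
      using out[of x] that by (simp add: V_def ball_cut_bounds[OF \<delta>])
    show "((\<lambda>s. V (x + s *\<^sub>R i)) has_real_derivative flux_div \<delta> t i x) (at 0)" for x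
    proof (cases "x \<in> ball 0 1")
      case True
      have d: "((\<lambda>s. D (x + s *\<^sub>R i, t) u) has_real_derivative H (x, t) (i, 0) u) (at 0)" for u
        using derivs2_along_line(2)[OF derivs, of "(x, t)" 0 "(i, 0)" u] True t by simp
      from DERIV_mult[OF ball_cut_deriv[of \<delta> x i] DERIV_mult[OF d[of "(0, 1)"] d[of "(i, 0)"]]] show ?thesis
        by (simp add: V_def flux_div_def algebra_simps)
    next
      case False
      have "x \<bullet> x \<ge> 1" using False by (simp add: dot_square_norm)
      \<comment> \<open>Off the open ball \<open>D\<close> and \<open>H\<close> carry no
        information, but \<open>1 - y \<bullet> y < \<delta>\<close> is an open condition that holds
        at \<open>x\<close>, so \<open>V\<close> is identically 0 nearby.\<close>
      have op: "open ((\<lambda>s::real. x + s *\<^sub>R i) -` {y. 1 - y \<bullet> y < \<delta>})"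
        by (intro open_vimage continuous_intros open_Collect_less)
      have "((\<lambda>s::real. 0::real) has_real_derivative 0) (at 0)" by simp
      then have "((\<lambda>s. V (x + s *\<^sub>R i)) has_real_derivative 0) (at 0)"
        by (rule has_field_derivative_transform_within_open[OF _ op])
          (use \<delta> \<open>x \<bullet> x \<ge> 1\<close> in \<open>auto simp: V_def ball_cut_bounds\<close>)
      then show ?thesis using out[OF False] by (simp add: flux_div_def ball_cut_bounds[OF \<delta>])
    qed
  qed (use meas bd in auto)
qed

text \<open>The usual factor 1/2 is left out, whence the 2 in \<open>energy_deriv\<close>.\<close>

definition energy :: "real \<Rightarrow> real \<Rightarrow> real" where
  "energy \<delta> t = (\<integral>x. ball_cut \<delta> x * ((D (x, t) (0, 1))\<^sup>2 + (\<Sum>i\<in>Basis. (D (x, t) (i, 0))\<^sup>2)) \<partial>lborel)"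

text \<open>The part of the divergence in which the derivative falls on the cutoff: w_t \<nabla>w
  \<bullet> \<nabla>\<phi>.\<close>

definition shell_flux :: "real \<Rightarrow> real \<Rightarrow> 'a \<Rightarrow> real" where
  "shell_flux \<delta> t x = (\<Sum>i\<in>Basis. ball_cut' \<delta> i x * (D (x, t) (0, 1) * D (x, t) (i, 0)))"

lemma density_bounds:
  assumes "\<delta> > 0" "0 \<le> t" "t \<le> T"
  shows "\<bar>ball_cut \<delta> x * ((D (x, t) (0, 1))\<^sup>2 + (\<Sum>i\<in>Basis. (D (x, t) (i, 0))\<^sup>2))\<bar>
    \<le> (2 * (M\<^sup>2 + real DIM('a) * M\<^sup>2)) * indicator (cball 0 1) x"
    and "(\<lambda>x. ball_cut \<delta> x * ((D (x, t) (0, 1))\<^sup>2 + (\<Sum>i\<in>Basis. (D (x, t) (i, 0))\<^sup>2))) \<in> borel_measurable borel"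
proof -
  have out: "1 - x \<bullet> x \<le> \<delta>" if "x \<notin> ball 0 1" for x :: 'a
    using that in_ball_if_cutoff[OF assms(1), of x] by force
  have sq: "(D (x, t) v)\<^sup>2 \<le> M\<^sup>2" if "x \<in> cball 0 1" "norm v = 1" for v
    using power_mono[OF D_bound[OF that(1) assms(2,3) that(2)] abs_ge_zero, of 2] by simp
  show "\<bar>ball_cut \<delta> x * ((D (x, t) (0, 1))\<^sup>2 + (\<Sum>i\<in>Basis. (D (x, t) (i, 0))\<^sup>2))\<bar>
    \<le> (2 * (M\<^sup>2 + real DIM('a) * M\<^sup>2)) * indicator (cball 0 1) x"
  proof (cases "x \<in> cball 0 1")
    case True
    have "(\<Sum>i\<in>Basis. (D (x, t) (i, 0))\<^sup>2) \<le> (\<Sum>i\<in>(Basis::'a set). M\<^sup>2)"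
      by (intro sum_mono sq True unit_directions)
    then have "ball_cut \<delta> x * ((D (x, t) (0, 1))\<^sup>2 + (\<Sum>i\<in>Basis. (D (x, t) (i, 0))\<^sup>2)) \<le> 2 * (M\<^sup>2 + real DIM('a) * M\<^sup>2)"
      by (intro mult_mono add_mono sq True unit_directions ball_cut_bounds assms add_nonneg_nonneg sum_nonneg)
        (auto)
    moreover have "0 \<le> ball_cut \<delta> x * ((D (x, t) (0, 1))\<^sup>2 + (\<Sum>i\<in>Basis. (D (x, t) (i, 0))\<^sup>2))"
      by (intro mult_nonneg_nonneg ball_cut_bounds assms add_nonneg_nonneg sum_nonneg) auto
    ultimately show ?thesis using True by simp
  next
    case False
    then show ?thesis using out[of x] by (simp add: ball_cut_bounds[OF assms(1)])
  qed
  show "(\<lambda>x. ball_cut \<delta> x * ((D (x, t) (0, 1))\<^sup>2 + (\<Sum>i\<in>Basis. (D (x, t) (i, 0))\<^sup>2))) \<in> borel_measurable borel"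
    using assms by (intro borel_measurable_cutoff_mult[where S = "ball 0 1"]
        continuous_on_ball_cut continuous_on_add continuous_on_sum continuous_on_power continuous_on_mult
        continuous_D_ball ball_cut_bounds out) auto
qed

text \<open>Differentiation gives 2 \<phi> (w_t w_tt + \<nabla>w \<bullet> \<nabla>w_t). With w_tt
  replaced by the Laplacian this is twice the divergence of \<phi> w_t \<nabla>w minus 2 w_t
  \<nabla>w \<bullet> \<nabla>\<phi>, and the divergence integrates to 0.\<close>

lemma energy_deriv:
  assumes \<delta>: "\<delta> > 0" and t: "0 < t" "t < T"
    and S: "integrable lborel (shell_flux \<delta> t)"
  shows "(energy \<delta> has_real_derivative - 2 * (\<integral>x. shell_flux \<delta> t x \<partial>lborel)) (at t)"
proof -
  \<comment> \<open>Half the distance to the ends of the time interval keeps all times considered in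
    a compact part of it, where \<open>H_bound\<close> applies.\<close>
  define r where "r = min t (T - t) / 2"
  have r: "r > 0" "0 < t - r" "t + r < T" using t by (auto simp: r_def min_def field_simps)
  obtain B where B: "B \<ge> 0"
    "\<And>x s u v. 1 - x \<bullet> x > \<delta> \<Longrightarrow> t - r \<le> s \<Longrightarrow> s \<le> t + r \<Longrightarrow> norm u = 1 \<Longrightarrow> norm v = 1 \<Longrightarrow> \<bar>H (x, s) u v\<bar> \<le> B"
    using H_bound[OF \<delta> r(2,3)] by metis
  have out: "1 - x \<bullet> x \<le> \<delta>" if "x \<notin> ball 0 1" for x :: 'a
    using that in_ball_if_cutoff[OF \<delta>, of x] by force
  define g where "g x s = ball_cut \<delta> x * (2 * D (x, s) (0, 1) * H (x, s) (0, 1) (0, 1)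
     + (\<Sum>i\<in>Basis. 2 * D (x, s) (i, 0) * H (x, s) (0, 1) (i, 0)))" for x s
  define C where "C = 2 * (2 * M * B + (\<Sum>i\<in>(Basis::'a set). 2 * M * B))"
  have "((\<lambda>t. \<integral>x. ball_cut \<delta> x * ((D (x, t) (0, 1))\<^sup>2 + (\<Sum>i\<in>Basis. (D (x, t) (i, 0))\<^sup>2)) \<partial>lborel)
      has_real_derivative (\<integral>x. g x t \<partial>lborel)) (at t)"
  proof (rule has_real_derivative_integral_dominated[OF r(1), where B = "\<lambda>x. C * indicator (cball 0 1) x"])
    fix s assume "\<bar>s - t\<bar> < r"
    then have s: "0 \<le> s" "s \<le> T" using r by auto
    show "integrable lborel (\<lambda>x. ball_cut \<delta> x * ((D (x, s) (0, 1))\<^sup>2 + (\<Sum>i\<in>Basis. (D (x, s) (i, 0))\<^sup>2)))"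
      by (rule Bochner_Integration.integrable_bound[OF integrable_indicator_cball])
        (use density_bounds[OF \<delta> s] in \<open>auto intro!: AE_I2 order_trans[OF _ abs_ge_self]\<close>)
  next
    show "AE x in lborel. \<forall>s. \<bar>s - t\<bar> < r \<longrightarrow>
      ((\<lambda>t. ball_cut \<delta> x * ((D (x, t) (0, 1))\<^sup>2 + (\<Sum>i\<in>Basis. (D (x, t) (i, 0))\<^sup>2)))
        has_real_derivative g x s) (at s) \<and> \<bar>g x s\<bar> \<le> C * indicator (cball 0 1) x"
    proof (intro AE_I2 allI impI)
      fix x s assume "\<bar>s - t\<bar> < r"
      then have s: "t - r \<le> s" "s \<le> t + r" "0 < s" "s < T" using r by auto
      show "((\<lambda>t. ball_cut \<delta> x * ((D (x, t) (0, 1))\<^sup>2 + (\<Sum>i\<in>Basis. (D (x, t) (i, 0))\<^sup>2)))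
        has_real_derivative g x s) (at s) \<and> \<bar>g x s\<bar> \<le> C * indicator (cball 0 1) x"
      proof (cases "1 - x \<bullet> x \<le> \<delta>")
        case True
        moreover have "C \<ge> 0" using B(1) M_nonneg by (simp add: C_def)
        ultimately show ?thesis by (simp add: g_def ball_cut_bounds[OF \<delta>])
      next
        case False
        then have x: "x \<in> ball 0 1" using out by force
        have d: "((\<lambda>s. D (x, s) u) has_real_derivative H (x, s) (0, 1) u) (at s)" for u
          using derivs2_along_line(2)[OF derivs, of "(x, 0)" s "(0, 1)" u] x s by simp
        have "((\<lambda>t. ball_cut \<delta> x * ((D (x, t) (0, 1))\<^sup>2 + (\<Sum>i\<in>Basis. (D (x, t) (i, 0))\<^sup>2)))
           has_real_derivative g x s) (at s)"
          unfolding g_def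
          by (intro DERIV_cmult DERIV_add DERIV_sum) (rule derivative_eq_intros d refl | simp)+
        moreover have "\<bar>g x s\<bar> \<le> C"
        proof -
          have D: "\<bar>D (x, s) v\<bar> \<le> M" if "norm v = 1" for v
            using D_bound[of x s v] x s that by simp
          have H: "\<bar>H (x, s) u v\<bar> \<le> B" if "norm u = 1" "norm v = 1" for u v
            using B(2) False s that by simp
          have p: "\<bar>2 * D (x, s) v * H (x, s) (0, 1) v\<bar> \<le> 2 * M * B" if "norm v = 1" for v
            unfolding abs_mult using D[OF that] H[OF unit_directions(1) that] M_nonneg by (intro mult_mono) auto
          have "\<bar>\<Sum>i\<in>Basis. 2 * D (x, s) (i, 0) * H (x, s) (0, 1) (i, 0)\<bar> \<le> (\<Sum>i\<in>(Basis::'a set). 2 * M * B)"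
            by (intro order_trans[OF sum_abs] sum_mono p unit_directions)
          then show ?thesis
            unfolding g_def C_def abs_mult using ball_cut_bounds(1,2)[OF \<delta>, of x] p[OF unit_directions(1)]
            by (intro mult_mono order_trans[OF abs_triangle_ineq] add_mono) auto
        qed
        ultimately show ?thesis using x by simp
      qed
    qed
    show "integrable lborel (\<lambda>x::'a. C * indicator (cball 0 1) x)"
      by (rule integrable_indicator_cball)
    show "(\<lambda>x. g x t) \<in> borel_measurable lborel"
      unfolding g_def measurable_lborel2
      using t by (intro borel_measurable_cutoff_mult[where S = "ball 0 1"]
        continuous_on_ball_cut continuous_on_add continuous_on_sum continuous_on_mult continuous_on_const continuous_H
        continuous_D_ball ball_cut_bounds[OF \<delta>] out) auto
  qed
  moreover have "g x t = 2 * (\<Sum>i\<in>Basis. flux_div \<delta> t i x) - 2 * shell_flux \<delta> t x" for x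
  proof (cases "x \<in> ball 0 1")
    case True
    then have z: "(x, t) \<in> ball 0 1 \<times> {0<..<T}" using t by simp
    \<comment> \<open>The divergence produces spatial derivatives of w_t, the time derivative of the
      energy produces time derivatives of \<nabla>w; Schwarz's theorem identifies them.\<close>
    have sym: "H (x, t) (i, 0) (0, 1) = H (x, t) (0, 1) (i, 0)" for i
      by (rule derivs2_symmetric[OF derivs z])
    have "(\<Sum>i\<in>Basis. flux_div \<delta> t i x) = shell_flux \<delta> t x
       + ball_cut \<delta> x * ((\<Sum>i\<in>Basis. D (x, t) (i, 0) * H (x, t) (0, 1) (i, 0)) + D (x, t) (0, 1) * H (x, t) (0, 1) (0, 1))"
      unfolding flux_div_def shell_flux_def wave[OF z] sym
      by (simp add: sum.distrib sum_distrib_left distrib_left mult_ac)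
    then show ?thesis
      by (simp add: g_def sum_distrib_left algebra_simps)
  next
    case False
    then show ?thesis using out by (simp add: g_def flux_div_def shell_flux_def ball_cut_bounds[OF \<delta>])
  qed
  moreover have "(\<integral>x. 2 * (\<Sum>i\<in>Basis. flux_div \<delta> t i x) - 2 * shell_flux \<delta> t x \<partial>lborel)
      = - 2 * (\<integral>x. shell_flux \<delta> t x \<partial>lborel)"
    using flux_div_integral[OF \<delta> t] S by simp
  ultimately show ?thesis
    unfolding energy_def[abs_def] by simp
qed

text \<open>With \<open>d = DIM('a)\<close>: the \<open>d\<close> directions contribute
  \<open>4 / \<delta> * \<eta> * M\<close> each, and the shell has volume at most
  \<open>3 * d * \<delta>\<close> times that of the unit ball. The powers of \<open>\<delta>\<close>
  cancel, so smallness comes from \<open>\<eta>\<close> alone.\<close>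

lemma shell_flux_small:
  assumes \<delta>: "\<delta> > 0" "3 * \<delta> \<le> 1" and t: "0 < t" "t < T"
    and \<eta>: "\<And>x. x \<in> cball 0 1 \<Longrightarrow> 1 - x \<bullet> x < 3 * \<delta> \<Longrightarrow> \<bar>D (x, t) (0, 1)\<bar> \<le> \<eta>"
  shows "integrable lborel (shell_flux \<delta> t)"
    and "\<bar>\<integral>x. shell_flux \<delta> t x \<partial>lborel\<bar> \<le> 12 * (real DIM('a))\<^sup>2 * unit_ball_vol DIM('a) * M * \<eta>"
proof -
  define A where "A = cball 0 1 - ball (0::'a) (sqrt (1 - 3 * \<delta>))"
  define C where "C = real DIM('a) * (4 / \<delta> * (\<eta> * M))"
  obtain e :: 'a where "e \<in> Basis" using nonempty_Basis by blast
  then have "e \<bullet> e = 1" "norm e = 1" by auto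
  \<comment> \<open>A unit vector lies in the layer for every \<open>\<delta>\<close>, so
    \<open>\<eta>\<close> bounds an absolute value there.\<close>
  then have \<eta>0: "\<eta> \<ge> 0" using \<eta>[of e] \<delta> by fastforce
  have out: "1 - x \<bullet> x \<le> \<delta>" if "x \<notin> ball 0 1" for x :: 'a
    using that in_ball_if_cutoff[OF \<delta>(1), of x] by force
  have bd: "\<bar>shell_flux \<delta> t x\<bar> \<le> C * indicator A x" for x
  proof (cases "x \<in> cball 0 1 \<and> 1 - x \<bullet> x < 3 * \<delta>")
    case True
    have "1 - 3 * \<delta> \<le> (norm x)\<^sup>2" using True by (simp add: power2_norm_eq_inner)
    then have "sqrt (1 - 3 * \<delta>) \<le> norm x" by (rule real_le_lsqrt[OF norm_ge_zero])
    then have "x \<in> A" using True by (simp add: A_def)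
    have "\<bar>shell_flux \<delta> t x\<bar> \<le> (\<Sum>i\<in>(Basis::'a set). 4 / \<delta> * (\<eta> * M))"
      unfolding shell_flux_def
    proof (intro order_trans[OF sum_abs] sum_mono)
      fix i :: 'a assume i: "i \<in> Basis"
      show "\<bar>ball_cut' \<delta> i x * (D (x, t) (0, 1) * D (x, t) (i, 0))\<bar> \<le> 4 / \<delta> * (\<eta> * M)"
        unfolding abs_mult using True t \<delta> \<eta>0 M_nonneg i
        by (intro mult_mono ball_cut_bounds(7) \<eta> D_bound unit_directions mult_nonneg_nonneg) auto
    qed
    then show ?thesis using \<open>x \<in> A\<close> by (simp add: C_def)
  next
    case False
    then have "1 - x \<bullet> x \<ge> 3 * \<delta> \<or> 1 - x \<bullet> x \<le> \<delta>" using out[of x] by force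
    then have "ball_cut' \<delta> i x = 0" for i using ball_cut_bounds(5,6)[OF \<delta>(1)] by blast
    then have "shell_flux \<delta> t x = 0" by (simp add: shell_flux_def)
    then show ?thesis using \<eta>0 M_nonneg \<delta> by (simp add: C_def)
  qed
  have meas: "shell_flux \<delta> t \<in> borel_measurable borel"
    unfolding shell_flux_def[abs_def]
    using t by (intro borel_measurable_sum borel_measurable_cutoff_mult[where S = "ball 0 1"]
        continuous_on_ball_cut' continuous_on_mult
        continuous_D_ball ball_cut_bounds[OF \<delta>(1)] out) auto
  have A: "A \<in> sets lborel" "emeasure lborel A < \<infinity>"
    unfolding A_def using emeasure_lborel_cball_finite[of "0::'a" 1]
    by (auto intro: order.strict_trans1[OF emeasure_mono])
  then have intA: "integrable lborel (\<lambda>x. C * indicator A x)"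
    by (intro integrable_mult_right integrable_real_indicator)
  show int: "integrable lborel (shell_flux \<delta> t)"
    by (rule Bochner_Integration.integrable_bound[OF intA])
      (use meas bd in \<open>auto intro!: AE_I2 order_trans[OF bd abs_ge_self]\<close>)
  have "\<bar>\<integral>x. shell_flux \<delta> t x \<partial>lborel\<bar> \<le> (\<integral>x. C * indicator A x \<partial>lborel)"
    by (rule order_trans[OF integral_abs_bound integral_mono[OF _ intA]]) (use int bd in auto)
  also have "\<dots> = C * measure lborel A" using A by simp
  also have "\<dots> \<le> C * (unit_ball_vol (DIM('a)) * (DIM('a) * (3 * \<delta>)))"
    unfolding A_def using \<eta>0 M_nonneg \<delta> by (intro mult_left_mono shell_measure_le) (auto simp: C_def)
  also have "\<dots> = 12 * (real DIM('a))\<^sup>2 * unit_ball_vol DIM('a) * M * \<eta>"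
    using \<delta> by (simp add: C_def power2_eq_square)
  finally show "\<bar>\<integral>x. shell_flux \<delta> t x \<partial>lborel\<bar> \<le> 12 * (real DIM('a))\<^sup>2 * unit_ball_vol DIM('a) * M * \<eta>" .
qed

text \<open>The energy starts at 0 and grows at a rate of at most twice the shell bound, over a time
  of at most \<open>T\<close>.\<close>

lemma energy_small:
  assumes \<delta>: "\<delta> > 0" "3 * \<delta> \<le> 1" and t: "0 < t" "t < T"
    and \<eta>: "\<And>x t. x \<in> cball 0 1 \<Longrightarrow> 0 \<le> t \<Longrightarrow> t \<le> T \<Longrightarrow> 1 - x \<bullet> x < 3 * \<delta> \<Longrightarrow> \<bar>D (x, t) (0, 1)\<bar> \<le> \<eta>"
  shows "energy \<delta> t \<le> 24 * (real DIM('a))\<^sup>2 * unit_ball_vol DIM('a) * M * \<eta> * T"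
proof -
  let ?C = "12 * (real DIM('a))\<^sup>2 * unit_ball_vol DIM('a) * M * \<eta>"
  have out: "1 - x \<bullet> x \<le> \<delta>" if "x \<notin> ball 0 1" for x :: 'a
    using that in_ball_if_cutoff[OF \<delta>(1), of x] by force
  have d0: "ball_cut \<delta> x * ((D (x, 0) (0, 1))\<^sup>2 + (\<Sum>i\<in>Basis. (D (x, 0) (i, 0))\<^sup>2)) = 0" for x
    using init[of x] out[of x] ball_cut_bounds(3)[OF \<delta>(1), of x] by (cases "x \<in> ball 0 1") auto
  then have E0: "energy \<delta> 0 = 0" unfolding energy_def d0 by simp
  \<comment> \<open>\<open>energy_deriv\<close> covers positive times only. Reaching the initial
    value 0 takes continuity at time 0, which rests on \<open>D\<close> being continuous on the
    closed cylinder.\<close>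
  have "continuous_on {0..t} (energy \<delta>)"
    unfolding energy_def[abs_def]
  proof (rule continuous_on_integral_dominated)
    show "AE x in lborel. continuous_on {0..t}
        (\<lambda>t. ball_cut \<delta> x * ((D (x, t) (0, 1))\<^sup>2 + (\<Sum>i\<in>Basis. (D (x, t) (i, 0))\<^sup>2))) \<and>
      (\<forall>t\<in>{0..t}. \<bar>ball_cut \<delta> x * ((D (x, t) (0, 1))\<^sup>2 + (\<Sum>i\<in>Basis. (D (x, t) (i, 0))\<^sup>2))\<bar>
         \<le> (2 * (M\<^sup>2 + real DIM('a) * M\<^sup>2)) * indicator (cball 0 1) x)"
    proof (intro AE_I2 conjI ballI)
      fix x s assume "s \<in> {0..t}"
      then show "\<bar>ball_cut \<delta> x * ((D (x, s) (0, 1))\<^sup>2 + (\<Sum>i\<in>Basis. (D (x, s) (i, 0))\<^sup>2))\<bar>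
         \<le> (2 * (M\<^sup>2 + real DIM('a) * M\<^sup>2)) * indicator (cball 0 1) x"
        using t by (intro density_bounds \<delta>) auto
    next
      fix x :: 'a
      show "continuous_on {0..t} (\<lambda>t. ball_cut \<delta> x * ((D (x, t) (0, 1))\<^sup>2 + (\<Sum>i\<in>Basis. (D (x, t) (i, 0))\<^sup>2)))"
      proof (cases "x \<in> cball 0 1")
        case True
        have "continuous_on {0..t} (\<lambda>s. D (x, s))"
          by (rule continuous_on_compose2[OF cont]) (use True t in \<open>auto intro!: continuous_intros\<close>)
        then have "continuous_on {0..t} (\<lambda>s. D (x, s) v)" for v
          by (intro continuous_intros)
        then show ?thesis
          by (intro continuous_on_mult continuous_on_add continuous_on_sum continuous_on_power continuous_on_const)
      next
        case False
        then show ?thesis using out[of x] by (simp add: ball_cut_bounds[OF \<delta>(1)])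
      qed
    qed
  qed (use density_bounds(2)[OF \<delta>(1)] t integrable_indicator_cball in auto)
  moreover have der: "(energy \<delta> has_real_derivative - 2 * (\<integral>x. shell_flux \<delta> s x \<partial>lborel)) (at s)"
    if "0 < s" "s < t" for s
    using that t by (intro energy_deriv \<delta> shell_flux_small(1)[where \<eta> = \<eta>] \<eta>) auto
  ultimately obtain l s where s: "0 < s" "s < t" and l: "(energy \<delta> has_real_derivative l) (at s)"
    "energy \<delta> t - energy \<delta> 0 = (t - 0) * l"
    using MVT[OF t(1), of "energy \<delta>"] by (metis real_differentiable_def)
  have "l = - 2 * (\<integral>x. shell_flux \<delta> s x \<partial>lborel)" using DERIV_unique[OF l(1) der[OF s]] .
  moreover have b: "\<bar>\<integral>x. shell_flux \<delta> s x \<partial>lborel\<bar> \<le> ?C"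
    using s t by (intro shell_flux_small(2) \<delta> \<eta>) auto
  ultimately have l2: "l \<le> 2 * ?C" by linarith
  have "energy \<delta> t = t * l" using l(2) E0 by simp
  also have "\<dots> \<le> t * (2 * ?C)" using l2 t by (intro mult_left_mono) auto
  also have "\<dots> \<le> T * (2 * ?C)" using b t by (intro mult_right_mono) auto
  finally show ?thesis by (simp add: mult_ac)
qed

text \<open>The points with a time derivative of modulus at least \<open>\<eta>\<close> form a
  compact set that misses the lateral boundary; on it \<open>1 - x \<bullet> x\<close> has a
  positive minimum, and this is the width of the layer.\<close>

lemma boundary_layer:
  assumes bd: "\<And>x t. x \<in> sphere 0 1 \<Longrightarrow> t \<in> {0..T} \<Longrightarrow> D (x, t) (0, 1) = 0" and \<eta>: "\<eta> > 0"
  shows "\<exists>m>0. \<forall>x\<in>cball 0 1. \<forall>t\<in>{0..T}. 1 - x \<bullet> x < m \<longrightarrow> \<bar>D (x, t) (0, 1)\<bar> \<le> \<eta>"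
proof -
  let ?K = "cball (0::'a) 1 \<times> {0..T}"
  define A where "A = ?K \<inter> (\<lambda>z. \<bar>D z (0, 1)\<bar>) -` {\<eta>..}"
  have "compact A"
  proof -
    have "compact ?K" by (intro compact_Times) auto
    moreover have "continuous_on ?K (\<lambda>z. \<bar>D z (0, 1)\<bar>)"
      by (intro continuous_on_rabs bounded_linear.continuous_on[OF _ cont] blinfun.bounded_linear_left)
    then have "closed A"
      unfolding A_def by (rule continuous_closed_preimage) (auto intro: closed_Times)
    moreover have "A = ?K \<inter> A" by (auto simp: A_def)
    ultimately show ?thesis by (metis compact_Int_closed)
  qed
  show ?thesis
  proof (cases "A = {}")
    case True
    show ?thesis
    proof (intro exI[of _ 1] conjI ballI impI)
      fix x :: 'a and t assume x: "x \<in> cball 0 1" "t \<in> {0..T}"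
      have "(x, t) \<notin> A" using True by simp
      then show "\<bar>D (x, t) (0, 1)\<bar> \<le> \<eta>" using x by (auto simp: A_def)
    qed simp
  next
    case False
    have "continuous_on A (\<lambda>z. 1 - fst z \<bullet> fst z)" by (intro continuous_intros)
    then obtain z where z: "z \<in> A" "\<And>y. y \<in> A \<Longrightarrow> 1 - fst z \<bullet> fst z \<le> 1 - fst y \<bullet> fst y"
      using continuous_attains_inf[OF \<open>compact A\<close> False] by blast
    have "fst z \<notin> sphere 0 1"
    proof
      assume "fst z \<in> sphere 0 1"
      then have "D (fst z, snd z) (0, 1) = 0" using z(1) by (intro bd) (auto simp: A_def)
      then show False using z(1) \<eta> by (simp add: A_def)
    qed
    then have "fst z \<in> ball 0 1" using z(1) by (auto simp: A_def)
    then have "norm (fst z) * norm (fst z) < 1 * 1" by (intro mult_strict_mono') auto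
    then have pos: "1 - fst z \<bullet> fst z > 0" by (simp add: power2_norm_eq_inner[symmetric] power2_eq_square)
    show ?thesis
    proof (intro exI[of _ "1 - fst z \<bullet> fst z"] conjI ballI impI pos)
      fix x :: 'a and t assume x: "x \<in> cball 0 1" "t \<in> {0..T}" "1 - x \<bullet> x < 1 - fst z \<bullet> fst z"
      have "(x, t) \<notin> A" using z(2)[of "(x, t)"] x(3) by auto
      then show "\<bar>D (x, t) (0, 1)\<bar> \<le> \<eta>" using x by (auto simp: A_def)
    qed
  qed
qed

text \<open>A nonzero time derivative at one point persists on a small ball and bounds the energy
  below independently of \<open>\<delta>\<close>, while \<open>energy_small\<close> pushes it below
  any positive number.\<close>

lemma time_derivative_eq_0:
  assumes bd: "\<And>x t. x \<in> sphere 0 1 \<Longrightarrow> t \<in> {0..T} \<Longrightarrow> D (x, t) (0, 1) = 0"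
    and x: "x \<in> ball 0 1" and t: "0 < t" "t < T"
  shows "D (x, t) (0, 1) = 0"
proof (rule ccontr)
  assume "D (x, t) (0, 1) \<noteq> 0"
  define c where "c = \<bar>D (x, t) (0, 1)\<bar> / 2"
  then have c: "c > 0" "c < \<bar>D (x, t) (0, 1)\<bar>" using \<open>D (x, t) (0, 1) \<noteq> 0\<close> by auto
  have op: "open (ball 0 1 \<inter> (\<lambda>y. \<bar>D (y, t) (0, 1)\<bar>) -` {c<..})"
    using t by (intro continuous_open_preimage continuous_on_rabs continuous_D_ball) auto
  have "x \<in> ball 0 1 \<inter> (\<lambda>y. \<bar>D (y, t) (0, 1)\<bar>) -` {c<..}" using c x by simp
  from bspec[OF open_contains_cball[THEN iffD1, OF op] this]
  obtain s where s: "s > 0" "cball x s \<subseteq> ball 0 1 \<inter> (\<lambda>y. \<bar>D (y, t) (0, 1)\<bar>) -` {c<..}"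
    by (elim exE conjE)
  define v where "v = measure lborel (cball x s)"
  have v: "v > 0" unfolding v_def using s(1) by (simp add: content_cball_pos)
  have "compact (cball x s)" "cball x s \<noteq> {}" using s(1) by auto
  moreover have "continuous_on (cball x s) (\<lambda>y. 1 - y \<bullet> y)" by (intro continuous_intros)
  \<comment> \<open>\<open>y0\<close> is the point of the small ball nearest to the sphere; it
    decides how small \<open>\<delta>\<close> must be for the cutoff to equal 2 on the whole small
    ball.\<close>
  ultimately have "\<exists>y0\<in>cball x s. \<forall>y\<in>cball x s. 1 - y0 \<bullet> y0 \<le> 1 - y \<bullet> y"
    by (rule continuous_attains_inf)
  then obtain y0 where y0: "y0 \<in> cball x s" "\<And>y. y \<in> cball x s \<Longrightarrow> 1 - y0 \<bullet> y0 \<le> 1 - y \<bullet> y"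
    by blast
  have "y0 \<in> ball 0 1" using y0(1) s(2) by blast
  then have "norm y0 * norm y0 < 1 * 1" by (intro mult_strict_mono') auto
  then have pos: "1 - y0 \<bullet> y0 > 0" by (simp add: power2_norm_eq_inner[symmetric] power2_eq_square)
  define C where "C = 24 * (real DIM('a))\<^sup>2 * unit_ball_vol DIM('a) * M * T"
  have C: "C \<ge> 0" using M_nonneg T by (simp add: C_def)
  \<comment> \<open>Chosen so that \<open>C * \<eta>\<close> falls strictly below
    \<open>c\<^sup>2 * v\<close>; the summand 1 also covers \<open>C = 0\<close>.\<close>
  define \<eta> where "\<eta> = c\<^sup>2 * v / (C + 1)"
  have \<eta>: "\<eta> > 0" using c v C by (simp add: \<eta>_def)
  obtain m where m: "m > 0"
    "\<And>x t. x \<in> cball 0 1 \<Longrightarrow> 0 \<le> t \<Longrightarrow> t \<le> T \<Longrightarrow> 1 - x \<bullet> x < m \<Longrightarrow> \<bar>D (x, t) (0, 1)\<bar> \<le> \<eta>"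
    using boundary_layer[OF bd \<eta>] by auto
  \<comment> \<open>\<open>3 * \<delta>\<close> is kept below 1 for the shell volume, below
    \<open>m\<close> for the boundary layer, and below \<open>1 - y0 \<bullet> y0\<close> for the
    small ball.\<close>
  define \<delta> where "\<delta> = min (1 - y0 \<bullet> y0) (min m 1) / 3"
  have \<delta>: "\<delta> > 0" "3 * \<delta> \<le> 1" "3 * \<delta> \<le> m" "3 * \<delta> \<le> 1 - y0 \<bullet> y0" using pos m(1) by (auto simp: \<delta>_def)
  have "energy \<delta> t \<le> 24 * (real DIM('a))\<^sup>2 * unit_ball_vol DIM('a) * M * \<eta> * T"
    by (rule energy_small[OF \<delta>(1,2) t]) (use m(2) \<delta>(3) in auto)
  also have "\<dots> = C * \<eta>" by (simp add: C_def)
  also have "\<dots> < c\<^sup>2 * v" using C c v by (simp add: \<eta>_def divide_simps)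
  also have "\<dots> \<le> energy \<delta> t"
  proof -
    have "c\<^sup>2 * v = (\<integral>y. c\<^sup>2 * indicator (cball x s) y \<partial>lborel)"
      using emeasure_lborel_cball_finite[of x s] by (simp add: v_def)
    also have "\<dots> \<le> energy \<delta> t"
      unfolding energy_def
    proof (rule integral_mono[OF integrable_indicator_cball])
      show "integrable lborel (\<lambda>x. ball_cut \<delta> x * ((D (x, t) (0, 1))\<^sup>2 + (\<Sum>i\<in>Basis. (D (x, t) (i, 0))\<^sup>2)))"
        by (rule Bochner_Integration.integrable_bound[OF integrable_indicator_cball])
          (use density_bounds[OF \<delta>(1), of t] t in \<open>auto intro!: AE_I2 order_trans[OF _ abs_ge_self]\<close>)
      fix y
      show "c\<^sup>2 * indicator (cball x s) y \<le> ball_cut \<delta> y * ((D (y, t) (0, 1))\<^sup>2 + (\<Sum>i\<in>Basis. (D (y, t) (i, 0))\<^sup>2))"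
      proof (cases "y \<in> cball x s")
        case True
        then have "3 * \<delta> \<le> 1 - y \<bullet> y" using y0(2) \<delta>(4) by fastforce
        then have "ball_cut \<delta> y = 2" by (rule ball_cut_bounds(4)[OF \<delta>(1)])
        have "c\<^sup>2 \<le> \<bar>D (y, t) (0, 1)\<bar>\<^sup>2" using True s(2) c by (intro power_mono) auto
        then have "c\<^sup>2 \<le> (D (y, t) (0, 1))\<^sup>2" by simp
        also have "\<dots> \<le> 2 * ((D (y, t) (0, 1))\<^sup>2 + (\<Sum>i\<in>Basis. (D (y, t) (i, 0))\<^sup>2))"
          using sum_nonneg[of Basis "\<lambda>i. (D (y, t) (i, 0))\<^sup>2"] by simp
        finally show ?thesis using True \<open>ball_cut \<delta> y = 2\<close> by simp
      next
        case False
        then show ?thesis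
          by (simp, intro mult_nonneg_nonneg ball_cut_bounds \<delta> add_nonneg_nonneg sum_nonneg) auto
      qed
    qed
    finally show ?thesis .
  qed
  finally show False by simp
qed

end

section \<open>Uniqueness for the problem in the cylinder\<close>

lemma real_derivative_unique_interval:
  fixes g :: "real \<Rightarrow> real"
  assumes "a < b" "t \<in> {a..b}"
    and "(g has_real_derivative d) (at t within {a..b})" "(g has_real_derivative e) (at t within {a..b})"
  shows "d = e"
  using vector_derivative_unique_within_closed_interval[of a b t g d e] assms
  by (simp add: has_real_derivative_iff_has_vector_derivative cbox_interval)

lemma has_real_derivative_time:
  assumes "((\<lambda>(x, t). v x t) has_derivative F) (at (x, t) within S \<times> I)" "x \<in> S"
  shows "((\<lambda>s. v x s) has_real_derivative F (0, 1)) (at t within I)"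
proof -
  have "((\<lambda>s. (x, s)) has_derivative (\<lambda>h. (0, h))) (at t within I)"
    by (intro has_derivative_Pair has_derivative_const has_derivative_ident)
  moreover have "((\<lambda>(x, t). v x t) has_derivative F) (at (x, t) within (\<lambda>s. (x, s)) ` I)"
    by (rule has_derivative_subset[OF assms(1)]) (use assms(2) in auto)
  ultimately have "((\<lambda>s. (\<lambda>(x, t). v x t) (x, s)) has_derivative (\<lambda>h. F (0, h))) (at t within I)"
    by (rule has_derivative_in_compose)
  moreover have "(\<lambda>h. F (0, h)) = (*) (F (0, 1))"
  proof
    fix h
    have "F (h *\<^sub>R (0, 1)) = h *\<^sub>R F (0, 1)"
      by (rule linear_cmul[OF bounded_linear.linear[OF has_derivative_bounded_linear[OF assms(1)]]])
    then show "F (0, h) = F (0, 1) * h" by (simp add: mult.commute)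
  qed
  ultimately show ?thesis by (simp add: has_field_derivative_def)
qed

text \<open>The energy argument is used only to annihilate the time derivative; at each interior
  point \<open>w\<close> is then constant in time and equal to its initial value 0.\<close>

proposition wave_equation_unique_in_ball:
  fixes w :: "'a::euclidean_space \<Rightarrow> real \<Rightarrow> real"
  assumes T: "T > 0"
    and C2: "C2_on (\<lambda>(x, t). w x t) (ball 0 1 \<times> {0<..<T})"
    and C1: "C1_on (\<lambda>(x, t). w x t) (cball 0 1 \<times> {0..T})"
    and eq: "\<And>x t. x \<in> ball 0 1 \<Longrightarrow> t \<in> {0<..<T} \<Longrightarrow> wave_eq_at w x t"
    and bd: "\<And>x t. x \<in> sphere 0 1 \<Longrightarrow> t \<in> {0..T} \<Longrightarrow> w x t = 0"
    and i0: "\<And>x. x \<in> ball 0 1 \<Longrightarrow> w x 0 = 0"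
    and i1: "\<And>x. x \<in> ball 0 1 \<Longrightarrow> ((\<lambda>t. w x t) has_real_derivative 0) (at 0 within {0..T})"
    and x: "x \<in> cball 0 1" and t: "t \<in> {0..T}"
  shows "w x t = 0"
proof -
  let ?f = "\<lambda>(x, t). w x t" and ?Q = "ball (0::'a) 1 \<times> {0<..<T}" and ?K = "cball (0::'a) 1 \<times> {0..T}"
  have Q: "open ?Q" "?Q \<subseteq> ?K"
    by (simp_all add: open_Times Sigma_mono ball_subset_cball greaterThanLessThan_subseteq_atLeastAtMost_iff)
  obtain D H where derivs: "derivs2 ?Q ?f D H" and cD: "continuous_on ?K D"
      and D': "\<forall>z\<in>?K. (?f has_derivative blinfun_apply (D z)) (at z within ?K)"
    by (rule C2_on_C1_on_derivs2[OF C2 C1 Q])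
  note D = bspec[OF D']
  have "compact ?K" by (intro compact_Times) auto
  with cD have "bounded (D ` ?K)" by (intro compact_imp_bounded compact_continuous_image)
  then obtain M where M: "\<And>z. z \<in> ?K \<Longrightarrow> norm (D z) \<le> M"
    unfolding bounded_iff by blast
  have wt: "((\<lambda>s. w x s) has_real_derivative D (x, t) (0, 1)) (at t within {0..T})"
    if "x \<in> cball 0 1" "t \<in> {0..T}" for x t
    by (rule has_real_derivative_time[OF D]) (use that in auto)
  \<comment> \<open>The time component vanishes by \<open>i1\<close>, the spatial ones because
    \<open>w\<close> is zero on the whole slice \<open>t = 0\<close>.\<close>
  have init: "D (x, 0) = 0" if x: "x \<in> ball 0 1" for x
  proof (rule blinfun_eqI)
    fix v :: "'a \<times> real"
    obtain y s where v: "v = (y, s)" by (cases v)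
    have 1: "D (x, 0) (0, 1) = 0"
      by (rule real_derivative_unique_interval[OF T _ wt i1]) (use x T in auto)
    \<comment> \<open>The parameters for which the line stays in the open ball. As \<open>A\<close>
      is open, the derivative within the closed cylinder becomes a two-sided one along the
      slice.\<close>
    define A where "A = (\<lambda>s::real. x + s *\<^sub>R y) -` ball 0 1"
    have A: "open A" "0 \<in> A"
      unfolding A_def using x by (auto intro!: open_vimage continuous_intros)
    have "((\<lambda>s. (x + s *\<^sub>R y, 0)) has_derivative (\<lambda>h. (0 + h *\<^sub>R y, 0))) (at 0 within A)"
      by (intro has_derivative_Pair has_derivative_add has_derivative_const has_derivative_scaleR_left has_derivative_ident)
    then have "((\<lambda>s. (x + s *\<^sub>R y, 0)) has_derivative (\<lambda>h. (h *\<^sub>R y, 0))) (at 0 within A)"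
      by simp
    moreover have "(?f has_derivative D (x, 0)) (at (x + 0 *\<^sub>R y, 0) within (\<lambda>s. (x + s *\<^sub>R y, 0)) ` A)"
      unfolding scaleR_zero_left add_0_right
    proof (rule has_derivative_subset[OF D])
      show "(x, 0) \<in> ?K" using x T by simp
      show "(\<lambda>s. (x + s *\<^sub>R y, 0)) ` A \<subseteq> ?K"
        using T by (intro image_subsetI) (simp add: A_def)
    qed
    ultimately have "((\<lambda>s. ?f (x + s *\<^sub>R y, 0)) has_derivative (\<lambda>h. D (x, 0) (h *\<^sub>R y, 0))) (at 0 within A)"
      by (rule has_derivative_in_compose)
    then have "((\<lambda>s. w (x + s *\<^sub>R y) 0) has_derivative (\<lambda>h. D (x, 0) (h *\<^sub>R y, 0))) (at 0)"
      using at_within_open[OF A(2,1)] by simp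
    moreover have "((\<lambda>s. w (x + s *\<^sub>R y) 0) has_derivative (\<lambda>h. 0)) (at 0)"
      by (rule has_derivative_transform_within_open[OF has_derivative_const A])
        (use i0 in \<open>auto simp: A_def\<close>)
    ultimately have "(\<lambda>h::real. D (x, 0) (h *\<^sub>R y, 0)) = (\<lambda>h. 0)" by (rule has_derivative_unique)
    from fun_cong[OF this, of 1] have 2: "D (x, 0) (y, 0) = 0" by simp
    have "v = (y, 0) + s *\<^sub>R (0, 1)" by (simp add: v)
    then show "D (x, 0) v = blinfun_apply 0 v" using 1 2 by (simp only: blinfun.add_right blinfun.scaleR_right) simp
  qed
  have wave: "H z (0, 1) (0, 1) = (\<Sum>i\<in>Basis. H z (i, 0) (i, 0))" if z: "z \<in> ?Q" for z
  proof -
    have "(fst z, snd z) \<in> ?Q" "fst z \<in> ball 0 1" "snd z \<in> {0<..<T}" using z by auto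
    from wave_eq_at_derivs2[OF derivs this(1)] eq[OF this(2,3)] show ?thesis by simp
  qed
  interpret ball_wave ?f D H T M
    by (rule ball_wave.intro[OF T derivs cD M wave init])
  show ?thesis
  proof (cases "x \<in> ball 0 1")
    case True
    have "D (x, t) (0, 1) = 0" if "0 < t" "t < T" for t
    proof (rule time_derivative_eq_0[OF _ True that])
      \<comment> \<open>Zero boundary values at all times have zero time derivative; in this form
        the boundary condition enters the energy argument.\<close>
      fix x :: 'a and t assume xt: "x \<in> sphere 0 1" "t \<in> {0..T}"
      have "((\<lambda>s. w x s) has_real_derivative 0) (at t within {0..T})"
        by (rule has_field_derivative_transform_within[OF DERIV_const zero_less_one xt(2)])
          (simp add: bd[OF xt(1)])
      moreover have "((\<lambda>s. w x s) has_real_derivative D (x, t) (0, 1)) (at t within {0..T})"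
        by (rule wt) (use xt in auto)
      ultimately show "D (x, t) (0, 1) = 0"
        using real_derivative_unique_interval[OF T xt(2)] by blast
    qed
    then have "((\<lambda>s. w x s) has_real_derivative 0) (at t)" if "0 < t" "t < T" for t
      using wt[of x t] that True at_within_interior[of t "{0..T}"] by simp
    moreover have "continuous_on {0..T} (\<lambda>s. w x s)"
      by (rule DERIV_continuous_on[OF wt]) (use True in auto)
    ultimately have "w x t = w x 0"
      using DERIV_isconst2[OF T, of "\<lambda>s. w x s" t] t by auto
    then show ?thesis using i0[OF True] by simp
  next
    case False
    then show ?thesis using x t by (intro bd) auto
  qed
qed

section \<open>Spherical test waves\<close>

text \<open>Bounds are asked of the derivatives because each quotient by \<open>norm y\<close> is
  estimated by the mean value theorem one order higher.\<close>

locale radial_profile =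
  fixes h0 h1 h2 h3 :: "real \<Rightarrow> real" and \<epsilon> B :: real
  assumes \<epsilon>: "\<epsilon> > 0"
    and d0: "\<And>s. (h0 has_real_derivative h1 s) (at s)"
    and d1: "\<And>s. (h1 has_real_derivative h2 s) (at s)"
    and d2: "\<And>s. (h2 has_real_derivative h3 s) (at s)"
    and supp: "\<And>s. \<bar>s\<bar> \<ge> \<epsilon> \<Longrightarrow> h0 s = 0 \<and> h1 s = 0 \<and> h2 s = 0"
    and bound: "\<And>s. \<bar>h1 s\<bar> \<le> B \<and> \<bar>h2 s\<bar> \<le> B \<and> \<bar>h3 s\<bar> \<le> B"
    and even: "\<And>s. h0 (- s) = h0 s"
begin

text \<open>With \<open>h0\<close>, \<open>h1\<close>, \<open>h2\<close> for \<open>h\<close> this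
  is \<psi>, its first and its second derivative in \<tau>. The value 0 at \<open>y = 0\<close>
  comes from division by zero; the limit there would be 2 h'(\<tau>).\<close>

definition spherical_wave :: "(real \<Rightarrow> real) \<Rightarrow> 'a::real_normed_vector \<Rightarrow> real \<Rightarrow> real" where
  "spherical_wave h y \<tau> = (h (\<tau> + norm y) - h (\<tau> - norm y)) / norm y"

lemma B_nonneg: "B \<ge> 0"
  using bound[of 0] by linarith

lemma difference_bound:
  assumes "\<And>s. (h has_real_derivative h' s) (at s)" "\<And>s. \<bar>h' s\<bar> \<le> B" "r \<ge> 0"
  shows "\<bar>h (\<tau> + r) - h (\<tau> - r)\<bar> \<le> 2 * B * r"
proof -
  have "norm (h (\<tau> + r) - h (\<tau> - r)) \<le> B * norm ((\<tau> + r) - (\<tau> - r))"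
    by (rule field_differentiable_bound[where S = UNIV and f' = h']) (use assms in auto)
  then show ?thesis using assms(3) by simp
qed

lemma spherical_wave_bound:
  assumes "\<And>s. (h has_real_derivative h' s) (at s)" "\<And>s. \<bar>h' s\<bar> \<le> B"
  shows "\<bar>spherical_wave h y \<tau>\<bar> \<le> 2 * B"
proof (cases "norm y = 0")
  case True
  then show ?thesis using B_nonneg by (simp add: spherical_wave_def)
next
  case False
  then show ?thesis
    using difference_bound[OF assms norm_ge_zero, of \<tau> y] by (simp add: spherical_wave_def divide_simps)
qed

lemma spherical_wave_bounds: "\<bar>spherical_wave h0 y \<tau>\<bar> \<le> 2 * B" "\<bar>spherical_wave h1 y \<tau>\<bar> \<le> 2 * B" "\<bar>spherical_wave h2 y \<tau>\<bar> \<le> 2 * B"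
  using spherical_wave_bound[OF d0] spherical_wave_bound[OF d1] spherical_wave_bound[OF d2] bound by blast+

text \<open>Both arguments \<open>\<tau> + norm y\<close> and \<open>\<tau> - norm y\<close> leave
  the interval of radius \<open>\<epsilon>\<close>. The first alternative is the region ahead of the
  front, the second the region behind the trailing edge, on which Huygens' principle rests.\<close>

lemma spherical_wave_eq_0:
  assumes "norm y \<ge> \<bar>\<tau>\<bar> + \<epsilon> \<or> norm y \<le> \<tau> - \<epsilon>"
  shows "spherical_wave h0 y \<tau> = 0" "spherical_wave h1 y \<tau> = 0" "spherical_wave h2 y \<tau> = 0"
proof -
  have "\<bar>\<tau> + norm y\<bar> \<ge> \<epsilon>" "\<bar>\<tau> - norm y\<bar> \<ge> \<epsilon>"
    using assms norm_ge_zero[of y] by linarith+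
  from this[THEN supp] show "spherical_wave h0 y \<tau> = 0" "spherical_wave h1 y \<tau> = 0" "spherical_wave h2 y \<tau> = 0"
    by (simp_all add: spherical_wave_def)
qed

lemma spherical_wave_deriv:
  assumes "\<And>s. (h has_real_derivative h' s) (at s)"
  shows "((\<lambda>\<tau>. spherical_wave h y \<tau>) has_real_derivative spherical_wave h' y \<tau>) (at \<tau>)"
proof -
  have "((\<lambda>\<tau>. h (\<tau> + c)) has_real_derivative h' (\<tau> + c)) (at \<tau>)" for c
    using assms DERIV_shift by blast
  from DERIV_cdivide[OF DERIV_diff[OF this[of "norm y"] this[of "- norm y"]], of "norm y"]
  show ?thesis by (simp add: spherical_wave_def)
qed

lemma continuous_profile: "continuous_on S h0" "continuous_on S h1" "continuous_on S h2"
  using d0 d1 d2 by (meson DERIV_isCont continuous_at_imp_continuous_on)+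

lemma measurable_profile [measurable]:
  "h0 \<in> borel_measurable borel" "h1 \<in> borel_measurable borel" "h2 \<in> borel_measurable borel"
  by (simp_all add: borel_measurable_continuous_onI continuous_profile)

lemma measurable_spherical_wave [measurable]:
  assumes [measurable]: "h \<in> borel_measurable borel"
  shows "(\<lambda>y::'a::euclidean_space. spherical_wave h y \<tau>) \<in> borel_measurable borel"
  unfolding spherical_wave_def by measurable

text \<open>For \<open>\<psi>(y) = (h0 (\<tau> + |y|) - h0 (\<tau> - |y|)) / |y|\<close> and \<open>y \<noteq> 0\<close> one has \<open>\<partial>\<^sub>i \<psi> = \<alpha> y\<^sub>i\<close>; \<open>\<alpha>\<close> and \<open>\<beta>\<close>
  stay bounded as \<open>y \<rightarrow> 0\<close>, so the point \<open>0\<close> contributes nothing to the integrals (there all quotients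
  are \<open>0\<close> by \<open>x / 0 = 0\<close>).\<close>

definition \<alpha> :: "real \<Rightarrow> real \<Rightarrow> real" where
  "\<alpha> \<tau> r = (r * (h1 (\<tau> + r) + h1 (\<tau> - r)) - (h0 (\<tau> + r) - h0 (\<tau> - r))) / r ^ 3"

definition \<beta> :: "real \<Rightarrow> real \<Rightarrow> real" where
  "\<beta> \<tau> r = (h2 (\<tau> + r) - h2 (\<tau> - r)) / r"

lemma shift_derivs:
  assumes "\<And>s. (h has_real_derivative h' s) (at s)"
  shows "((\<lambda>r. h (\<tau> + r)) has_real_derivative h' (\<tau> + r)) (at r)"
    "((\<lambda>r. h (\<tau> - r)) has_real_derivative - h' (\<tau> - r)) (at r)"
proof -
  show "((\<lambda>r. h (\<tau> + r)) has_real_derivative h' (\<tau> + r)) (at r)"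
    using DERIV_shift[of h "h' (\<tau> + r)" r \<tau>] assms by (simp add: add.commute)
  have "((\<lambda>r. \<tau> - r) has_real_derivative - 1) (at r)"
    by (auto intro!: derivative_eq_intros)
  from DERIV_chain2[OF assms this] show "((\<lambda>r. h (\<tau> - r)) has_real_derivative - h' (\<tau> - r)) (at r)"
    by simp
qed

lemma numerator_deriv:
  "((\<lambda>r. r * (h1 (\<tau> + r) + h1 (\<tau> - r)) - (h0 (\<tau> + r) - h0 (\<tau> - r)))
     has_real_derivative r * (h2 (\<tau> + r) - h2 (\<tau> - r))) (at r)"
  by (rule derivative_eq_intros shift_derivs[OF d0] shift_derivs[OF d1] refl)+ (simp add: algebra_simps)

text \<open>The derivative of the numerator is \<open>r\<close> times a difference of
  \<open>h2\<close>-values, hence O(r^2); the numerator vanishes at 0, so it is O(r^3) and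
  compensates the denominator.\<close>

lemma \<alpha>_bound: "\<bar>\<alpha> \<tau> r\<bar> \<le> 2 * B" if "r \<ge> 0"
proof (cases "r = 0")
  case True
  then show ?thesis using B_nonneg by (simp add: \<alpha>_def)
next
  case False
  then have r: "r > 0" using that by simp
  define n where "n r = r * (h1 (\<tau> + r) + h1 (\<tau> - r)) - (h0 (\<tau> + r) - h0 (\<tau> - r))" for r
  have "norm (n r - n 0) \<le> (r * (2 * B * r)) * norm (r - 0)"
  proof (rule field_differentiable_bound[where S = "{0..r}" and f' = "\<lambda>r. r * (h2 (\<tau> + r) - h2 (\<tau> - r))"])
    fix s assume s: "s \<in> {0..r}"
    show "(n has_real_derivative s * (h2 (\<tau> + s) - h2 (\<tau> - s))) (at s within {0..r})"
      unfolding n_def by (rule has_field_derivative_at_within[OF numerator_deriv])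
    have "\<bar>h2 (\<tau> + s) - h2 (\<tau> - s)\<bar> \<le> 2 * B * s"
      using difference_bound[OF d2, of s] bound s by auto
    also have "\<dots> \<le> 2 * B * r" using s B_nonneg by (intro mult_left_mono) auto
    finally show "norm (s * (h2 (\<tau> + s) - h2 (\<tau> - s))) \<le> r * (2 * B * r)"
      using s by (simp only: real_norm_def abs_mult) (intro mult_mono, auto)
  qed (use r in auto)
  then have "\<bar>n r\<bar> \<le> 2 * B * r ^ 3" using r by (simp add: n_def power3_eq_cube mult_ac)
  then show ?thesis using r by (simp add: \<alpha>_def n_def[symmetric] divide_simps)
qed

lemma \<beta>_bound: "\<bar>\<beta> \<tau> r\<bar> \<le> 2 * B" if "r \<ge> 0"
proof (cases "r = 0")
  case False
  then show ?thesis
    using difference_bound[OF d2 _ that, of \<tau>] bound that by (simp add: \<beta>_def divide_simps)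
qed (use B_nonneg in \<open>simp add: \<beta>_def\<close>)

lemma \<alpha>_eq_0: "r \<ge> \<bar>\<tau>\<bar> + \<epsilon> \<Longrightarrow> \<alpha> \<tau> r = 0" and \<beta>_eq_0: "r \<ge> \<bar>\<tau>\<bar> + \<epsilon> \<Longrightarrow> \<beta> \<tau> r = 0"
proof -
  assume "r \<ge> \<bar>\<tau>\<bar> + \<epsilon>"
  then have "\<bar>\<tau> + r\<bar> \<ge> \<epsilon>" "\<bar>\<tau> - r\<bar> \<ge> \<epsilon>" by linarith+
  from this[THEN supp] show "\<alpha> \<tau> r = 0" "\<beta> \<tau> r = 0" by (simp_all add: \<alpha>_def \<beta>_def)
qed

text \<open>The second identity says r \<alpha>' = \<beta> - 3 \<alpha>. In dimension three the
  divergence of \<alpha> y is r \<alpha>' + 3 \<alpha>, so it collapses to \<beta>.\<close>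

lemma quotient_deriv:
  assumes "r > 0"
  shows "((\<lambda>r. (h0 (\<tau> + r) - h0 (\<tau> - r)) / r) has_real_derivative r * \<alpha> \<tau> r) (at r)"
    and "(\<alpha> \<tau> has_real_derivative (\<beta> \<tau> r - 3 * \<alpha> \<tau> r) / r) (at r)"
proof -
  have "((\<lambda>r. (h0 (\<tau> + r) - h0 (\<tau> - r)) / r) has_real_derivative
     ((h1 (\<tau> + r) - - h1 (\<tau> - r)) * r - (h0 (\<tau> + r) - h0 (\<tau> - r)) * 1) / (r * r)) (at r)"
    using assms by (intro DERIV_divide DERIV_diff shift_derivs d0 DERIV_ident) auto
  moreover have "((h1 (\<tau> + r) - - h1 (\<tau> - r)) * r - (h0 (\<tau> + r) - h0 (\<tau> - r)) * 1) / (r * r) = r * \<alpha> \<tau> r"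
    using assms by (simp add: \<alpha>_def power3_eq_cube mult_ac)
  ultimately show "((\<lambda>r. (h0 (\<tau> + r) - h0 (\<tau> - r)) / r) has_real_derivative r * \<alpha> \<tau> r) (at r)" by simp
  define n where "n r = r * (h1 (\<tau> + r) + h1 (\<tau> - r)) - (h0 (\<tau> + r) - h0 (\<tau> - r))" for r
  define k where "k = h2 (\<tau> + r) - h2 (\<tau> - r)"
  have "(n has_real_derivative r * k) (at r)"
    unfolding n_def k_def by (rule numerator_deriv)
  moreover have "((\<lambda>r. r ^ 3) has_real_derivative 3 * r ^ 2) (at r)"
    by (rule derivative_eq_intros refl)+ simp
  ultimately have "((\<lambda>r. n r / r ^ 3) has_real_derivative (r * k * r ^ 3 - n r * (3 * r ^ 2)) / (r ^ 3 * r ^ 3)) (at r)"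
    using assms by (intro DERIV_divide) auto
  moreover have "(r * k * r ^ 3 - n r * (3 * r ^ 2)) / (r ^ 3 * r ^ 3) = (k / r - 3 * (n r / r ^ 3)) / r"
    using assms by (simp add: field_simps power2_eq_square power3_eq_cube)
  ultimately show "(\<alpha> \<tau> has_real_derivative (\<beta> \<tau> r - 3 * \<alpha> \<tau> r) / r) (at r)"
    by (simp add: \<alpha>_def[abs_def] \<beta>_def n_def k_def)
qed

definition wave_grad :: "real \<Rightarrow> 'a::euclidean_space \<Rightarrow> 'a \<Rightarrow> real" where
  "wave_grad \<tau> i y = \<alpha> \<tau> (norm y) * (y \<bullet> i)"

text \<open>The second derivative of \<psi> taken twice in the direction \<open>i\<close>,
  simplified by r \<alpha>' = \<beta> - 3 \<alpha>; the Laplacian needs no mixed ones.\<close>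

definition wave_hess :: "real \<Rightarrow> 'a::euclidean_space \<Rightarrow> 'a \<Rightarrow> real" where
  "wave_hess \<tau> i y = \<alpha> \<tau> (norm y) + (y \<bullet> i)\<^sup>2 / (norm y)\<^sup>2 * (\<beta> \<tau> (norm y) - 3 * \<alpha> \<tau> (norm y))"

lemma norm_deriv_line:
  fixes y :: "'a::euclidean_space"
  assumes "y \<noteq> 0"
  shows "((\<lambda>s. norm (y + s *\<^sub>R i)) has_real_derivative (y \<bullet> i) / norm y) (at 0)"
proof -
  have "(norm has_derivative (\<lambda>h. h \<bullet> sgn (y + 0 *\<^sub>R i))) (at (y + 0 *\<^sub>R i))"
    using assms by (intro has_derivative_norm) auto
  from has_real_derivative_along_line[OF this]
  have "((\<lambda>s. norm (y + s *\<^sub>R i)) has_real_derivative i \<bullet> sgn y) (at 0)" by simp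
  then show ?thesis by (simp add: sgn_div_norm inner_commute divide_inverse mult.commute)
qed

lemma space_derivs:
  assumes "y \<noteq> 0" "norm i = 1"
  shows "((\<lambda>s. spherical_wave h0 (y + s *\<^sub>R i) \<tau>) has_real_derivative wave_grad \<tau> i y) (at 0)"
    and "((\<lambda>s. wave_grad \<tau> i (y + s *\<^sub>R i)) has_real_derivative wave_hess \<tau> i y) (at 0)"
proof -
  have r: "norm (y + 0 *\<^sub>R i) > 0" using assms by simp
  note n = norm_deriv_line[OF assms(1), of i]
  from DERIV_chain2[OF quotient_deriv(1)[OF r] n]
  show "((\<lambda>s. spherical_wave h0 (y + s *\<^sub>R i) \<tau>) has_real_derivative wave_grad \<tau> i y) (at 0)"
    using assms(1) by (simp add: spherical_wave_def wave_grad_def)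
  have "((\<lambda>s. (y + s *\<^sub>R i) \<bullet> i) has_real_derivative i \<bullet> i) (at 0)"
    unfolding inner_add_left inner_scaleR_left by (auto intro!: derivative_eq_intros)
  moreover have "i \<bullet> i = 1" using assms(2) by (simp add: dot_square_norm)
  ultimately have "((\<lambda>s. (y + s *\<^sub>R i) \<bullet> i) has_real_derivative 1) (at 0)" by simp
  note DERIV_mult[OF DERIV_chain2[OF quotient_deriv(2)[OF r] n] this, of \<tau>]
  moreover have "(\<beta> \<tau> (norm (y + 0 *\<^sub>R i)) - 3 * \<alpha> \<tau> (norm (y + 0 *\<^sub>R i))) / norm (y + 0 *\<^sub>R i) * (y \<bullet> i / norm y) * ((y + 0 *\<^sub>R i) \<bullet> i)
      + 1 * \<alpha> \<tau> (norm (y + 0 *\<^sub>R i)) = wave_hess \<tau> i y"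
    by (simp add: wave_hess_def power2_eq_square)
  ultimately show "((\<lambda>s. wave_grad \<tau> i (y + s *\<^sub>R i)) has_real_derivative wave_hess \<tau> i y) (at 0)"
    by (simp only: wave_grad_def)
qed

text \<open>Summation multiplies the leading \<alpha> by the dimension 3 and cancels the term
  subtracted in the second summand. What remains is \<beta>, so the Laplacian of \<psi> is its
  second derivative in \<tau>. At the origin both sides are 0 by division by zero.\<close>

lemma laplace_profile:
  assumes "DIM('a::euclidean_space) = 3"
  shows "(\<Sum>i\<in>Basis. wave_hess \<tau> i (y::'a)) = spherical_wave h2 y \<tau>"
proof (cases "y = 0")
  case True
  then show ?thesis using assms by (simp add: wave_hess_def spherical_wave_def \<alpha>_def)
next
  case False
  let ?c = "\<beta> \<tau> (norm y) - 3 * \<alpha> \<tau> (norm y)"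
  have "(\<Sum>i\<in>Basis. wave_hess \<tau> i y) = 3 * \<alpha> \<tau> (norm y) + (\<Sum>i\<in>Basis. (y \<bullet> i)\<^sup>2) / (norm y)\<^sup>2 * ?c"
    using assms by (simp add: wave_hess_def sum.distrib sum_distrib_right sum_divide_distrib)
  also have "(\<Sum>i\<in>Basis. (y \<bullet> i)\<^sup>2) = (norm y)\<^sup>2"
    by (simp add: norm_eq_sqrt_inner euclidean_inner[of y y] power2_eq_square sum_nonneg)
  finally show ?thesis using False by (simp add: \<beta>_def spherical_wave_def)
qed

lemma wave_grad_bound: "\<bar>wave_grad \<tau> i y\<bar> \<le> 2 * B * norm y" if "norm i = 1"
  unfolding wave_grad_def abs_mult
  using \<alpha>_bound[of "norm y" \<tau>] Cauchy_Schwarz_ineq2[of y i] that B_nonneg by (intro mult_mono) auto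

lemma wave_hess_bound: "\<bar>wave_hess \<tau> i y\<bar> \<le> 10 * B" if "norm i = 1"
proof -
  have "(y \<bullet> i)\<^sup>2 \<le> (norm y)\<^sup>2"
    using power_mono[OF Cauchy_Schwarz_ineq2[of y i] abs_ge_zero, of 2] that by simp
  then have q: "\<bar>(y \<bullet> i)\<^sup>2 / (norm y)\<^sup>2\<bar> \<le> 1" by (simp add: divide_le_eq_1)
  have a: "\<bar>\<alpha> \<tau> (norm y)\<bar> \<le> 2 * B" "\<bar>\<beta> \<tau> (norm y)\<bar> \<le> 2 * B" by (simp_all add: \<alpha>_bound \<beta>_bound)
  \<comment> \<open>Here 8 = 2 + 3 * 2; the leading term adds the 2 that makes up the 10.\<close>
  then have "\<bar>\<beta> \<tau> (norm y) - 3 * \<alpha> \<tau> (norm y)\<bar> \<le> 8 * B" by linarith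
  then have "\<bar>(y \<bullet> i)\<^sup>2 / (norm y)\<^sup>2 * (\<beta> \<tau> (norm y) - 3 * \<alpha> \<tau> (norm y))\<bar> \<le> 1 * (8 * B)"
    unfolding abs_mult using q by (intro mult_mono) auto
  from add_mono[OF a(1) this] show ?thesis
    unfolding wave_hess_def by (intro order_trans[OF abs_triangle_ineq]) simp
qed

lemma measurable_wave_grad_hess [measurable]:
  "wave_grad \<tau> i \<in> borel_measurable borel" "wave_hess \<tau> i \<in> borel_measurable borel"
  unfolding wave_grad_def[abs_def] wave_hess_def[abs_def] \<alpha>_def \<beta>_def by measurable

lemma wave_grad_hess_eq_0: "norm y \<ge> \<bar>\<tau>\<bar> + \<epsilon> \<Longrightarrow> wave_grad \<tau> i y = 0" "norm y \<ge> \<bar>\<tau>\<bar> + \<epsilon> \<Longrightarrow> wave_hess \<tau> i y = 0"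
  by (simp_all add: wave_grad_def wave_hess_def \<alpha>_eq_0 \<beta>_eq_0)

end

section \<open>Huygens' principle\<close>

text \<open>The derivative formulas of the test wave hold off the origin, and the exceptional set of
  the translation argument must be invariant along \<open>i\<close>. Hence a whole line is
  discarded, a null set in dimension above 1.\<close>

lemma AE_not_on_line:
  fixes i :: "'a::euclidean_space"
  assumes "DIM('a) > 1"
  shows "AE y in lborel. y \<notin> span {i}"
proof -
  have "dim (span {i}) \<le> 1"
    using dim_le_card'[of "{i}"] by simp
  then have "negligible (span {i})" using assms by (intro negligible_lowdim) linarith
  then have "span {i} \<in> null_sets (completion lborel)" by (simp add: negligible_iff_null_sets)
  moreover have "span {i} \<in> sets lborel" by (simp add: borel_closed closed_span)
  ultimately have "span {i} \<in> null_sets lborel" by (simp add: null_sets_completion_iff)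
  then show ?thesis by (rule AE_not_in)
qed

locale wave_in_space =
  fixes f :: "'a::euclidean_space \<times> real \<Rightarrow> real"
    and D :: "'a \<times> real \<Rightarrow> ('a \<times> real) \<Rightarrow>\<^sub>L real"
    and H :: "'a \<times> real \<Rightarrow> ('a \<times> real) \<Rightarrow>\<^sub>L ('a \<times> real) \<Rightarrow>\<^sub>L real"
  assumes dim3: "DIM('a) = 3"
    and derivs: "derivs2 (UNIV \<times> {0<..}) f D H"
    and contD: "continuous_on (UNIV \<times> {0..}) D"
    and contf: "continuous_on (UNIV \<times> {0..}) f"
    and wave: "\<And>x t. t > 0 \<Longrightarrow> H (x, t) (0, 1) (0, 1) = (\<Sum>i\<in>Basis. H (x, t) (i, 0) (i, 0))"
begin

lemma bounded_on_compact:
  fixes g :: "'a \<times> real \<Rightarrow> 'b::real_normed_vector"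
  assumes "continuous_on (UNIV \<times> I) g" "{t1..t2} \<subseteq> I"
  shows "\<exists>M\<ge>0. \<forall>y t. norm y \<le> R \<longrightarrow> t1 \<le> t \<longrightarrow> t \<le> t2 \<longrightarrow> norm (g (x0 + y, t)) \<le> M"
proof -
  have "compact (cball x0 R \<times> {t1..t2})" by (intro compact_Times) auto
  moreover have "continuous_on (cball x0 R \<times> {t1..t2}) g"
    using assms(2) by (intro continuous_on_subset[OF assms(1)] Sigma_mono) auto
  ultimately have "bounded (g ` (cball x0 R \<times> {t1..t2}))"
    by (intro compact_imp_bounded compact_continuous_image)
  then obtain M where M: "M > 0" "\<forall>v\<in>g ` (cball x0 R \<times> {t1..t2}). norm v \<le> M"
    unfolding bounded_pos by (elim exE conjE)
  have "norm (g (x0 + y, t)) \<le> M" if "norm y \<le> R" "t1 \<le> t" "t \<le> t2" for y t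
  proof (rule bspec[OF M(2)], rule imageI)
    show "(x0 + y, t) \<in> cball x0 R \<times> {t1..t2}" using that by (simp add: dist_norm)
  qed
  then show ?thesis using M(1) by (intro exI[of _ M]) simp
qed

lemma continuous_slices:
  assumes "0 \<le> t"
  shows "continuous_on UNIV (\<lambda>y. f (x0 + y, t))" "continuous_on UNIV (\<lambda>y. D (x0 + y, t) v)"
    "0 < t \<Longrightarrow> continuous_on UNIV (\<lambda>y. H (x0 + y, t) u v)"
proof -
  have *: "continuous_on UNIV (\<lambda>y. (x0 + y, t))" by (intro continuous_intros)
  show "continuous_on UNIV (\<lambda>y. f (x0 + y, t))"
    by (rule continuous_on_compose2[OF contf *]) (use assms in auto)
  have "continuous_on UNIV (\<lambda>y. D (x0 + y, t))"
    by (rule continuous_on_compose2[OF contD *]) (use assms in auto)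
  then show "continuous_on UNIV (\<lambda>y. D (x0 + y, t) v)" by (intro continuous_intros)
  assume "0 < t"
  then have "continuous_on UNIV (\<lambda>y. H (x0 + y, t))"
    by (intro continuous_on_compose2[OF derivs2D(4)[OF derivs] *]) auto
  then show "continuous_on UNIV (\<lambda>y. H (x0 + y, t) u v)" by (intro continuous_intros)
qed

lemmas measurable_slices = continuous_slices[THEN borel_measurable_continuous_onI]

lemma continuous_in_time:
  "continuous_on {0..} (\<lambda>t. f (x, t))" "continuous_on {0..} (\<lambda>t. D (x, t) v)"
proof -
  have *: "continuous_on {0..} (\<lambda>t. (x, t))" by (intro continuous_intros)
  show "continuous_on {0..} (\<lambda>t. f (x, t))"
    by (rule continuous_on_compose2[OF contf *]) auto
  have "continuous_on {0..} (\<lambda>t. D (x, t))"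
    by (rule continuous_on_compose2[OF contD *]) auto
  then show "continuous_on {0..} (\<lambda>t. D (x, t) v)" by (intro continuous_intros)
qed

end

lemma blinfun_apply_bound:
  fixes L :: "'a::real_normed_vector \<Rightarrow>\<^sub>L 'b::real_normed_vector"
  shows "norm L \<le> M \<Longrightarrow> norm v = 1 \<Longrightarrow> norm (L v) \<le> M"
  using norm_blinfun[of L v] by simp

section \<open>Pairing a solution with the test waves\<close>

locale wave_test = wave_in_space f D H + radial_profile h0 h1 h2 h3 \<epsilon> B
  for f :: "'a::euclidean_space \<times> real \<Rightarrow> real" and D H h0 h1 h2 h3 \<epsilon> B
begin

text \<open>Green's second identity: by the two wave equations the second time derivatives stand for
  the Laplacians of the solution and of the test wave. The origin leaves no point contribution,
  since the field and its derivatives stay bounded.\<close>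

lemma green_identity:
  assumes t: "t > 0"
  shows "(\<integral>y. H (x0 + y, t) (0, 1) (0, 1) * spherical_wave h0 y \<tau> - f (x0 + y, t) * spherical_wave h2 y \<tau> \<partial>lborel) = 0"
proof -
  define R where "R = \<bar>\<tau>\<bar> + \<epsilon>"
  have R: "R > 0" using \<epsilon> by (simp add: R_def)
  obtain M1 where M1: "M1 \<ge> 0" "\<And>y. norm y \<le> R \<Longrightarrow> norm (f (x0 + y, t)) \<le> M1"
    using bounded_on_compact[OF contf, of t t R x0] t by auto
  obtain M2 where M2: "M2 \<ge> 0" "\<And>y. norm y \<le> R \<Longrightarrow> norm (D (x0 + y, t)) \<le> M2"
    using bounded_on_compact[OF contD, of t t R x0] t by auto
  obtain M3 where M3: "M3 \<ge> 0" "\<And>y. norm y \<le> R \<Longrightarrow> norm (H (x0 + y, t)) \<le> M3"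
    using bounded_on_compact[OF derivs2D(4)[OF derivs], of t t R x0] t by auto
  define g where "g i y = f (x0 + y, t) * wave_hess \<tau> i y - spherical_wave h0 y \<tau> * H (x0 + y, t) (i, 0) (i, 0)" for i y
  define V where "V i y = f (x0 + y, t) * wave_grad \<tau> i y - spherical_wave h0 y \<tau> * D (x0 + y, t) (i, 0)" for i y
  have out: "spherical_wave h0 y \<tau> = 0" "wave_grad \<tau> i y = 0" "wave_hess \<tau> i y = 0" if "norm y > R" for y i :: 'a
    using that by (auto simp: R_def intro!: spherical_wave_eq_0 wave_grad_hess_eq_0)
  note ms = measurable_slices[OF less_imp_le[OF t]] measurable_slices(3)[OF less_imp_le[OF t] t]
  have g_meas: "g i \<in> borel_measurable borel" for i
    unfolding g_def[abs_def]
    by (intro borel_measurable_diff borel_measurable_times ms measurable_wave_grad_hess measurable_spherical_wave measurable_profile)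
  have V_meas: "V i \<in> borel_measurable borel" for i
    unfolding V_def[abs_def]
    by (intro borel_measurable_diff borel_measurable_times ms measurable_wave_grad_hess measurable_spherical_wave measurable_profile)
  have g_bd: "\<bar>g i y\<bar> \<le> M1 * (10 * B) + 2 * B * M3" if i: "i \<in> Basis" for i y
  proof (cases "norm y > R")
    case True
    then show ?thesis using M1(1) M3(1) B_nonneg by (simp add: g_def out)
  next
    case False
    then have y: "norm y \<le> R" by simp
    have "norm (H (x0 + y, t) (i, 0) (i, 0)) \<le> M3"
      by (intro blinfun_apply_bound M3 y unit_directions i)
    then have "\<bar>f (x0 + y, t) * wave_hess \<tau> i y\<bar> + \<bar>spherical_wave h0 y \<tau> * H (x0 + y, t) (i, 0) (i, 0)\<bar> \<le> M1 * (10 * B) + 2 * B * M3"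
      unfolding abs_mult using M1(1) M1(2)[OF y] B_nonneg wave_hess_bound[OF norm_Basis[OF i]] spherical_wave_bounds(1)[of y \<tau>]
      by (intro add_mono mult_mono) auto
    then show ?thesis unfolding g_def by (rule order_trans[OF abs_triangle_ineq4])
  qed
  have g_int: "integrable lborel (g i)" if i: "i \<in> Basis" for i
    by (rule integrable_bounded_support[OF g_meas g_bd[OF i], of R]) (simp add: g_def out)
  have V_bd: "\<bar>V i y\<bar> \<le> M1 * (2 * B * R) + 2 * B * M2" if i: "i \<in> Basis" for i y
  proof (cases "norm y > R")
    case True
    then show ?thesis using M1(1) M2(1) B_nonneg R by (simp add: V_def out)
  next
    case False
    then have y: "norm y \<le> R" by simp
    have "norm (D (x0 + y, t) (i, 0)) \<le> M2"
      by (intro blinfun_apply_bound M2 y unit_directions i)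
    moreover have "\<bar>wave_grad \<tau> i y\<bar> \<le> 2 * B * R"
      using wave_grad_bound[OF norm_Basis[OF i], of \<tau> y] y B_nonneg mult_left_mono[OF y, of "2 * B"] by linarith
    ultimately have "\<bar>f (x0 + y, t) * wave_grad \<tau> i y\<bar> + \<bar>spherical_wave h0 y \<tau> * D (x0 + y, t) (i, 0)\<bar> \<le> M1 * (2 * B * R) + 2 * B * M2"
      unfolding abs_mult using M1(1) M1(2)[OF y] B_nonneg spherical_wave_bounds(1)[of y \<tau>] R
      by (intro add_mono mult_mono) auto
    then show ?thesis unfolding V_def by (rule order_trans[OF abs_triangle_ineq4])
  qed
  \<comment> \<open>\<open>g i\<close> is the derivative along \<open>i\<close> of the Green field
    \<open>V i\<close>, off the line through the origin.\<close>
  have g0: "(\<integral>y. g i y \<partial>lborel) = 0" if i: "i \<in> Basis" for i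
  proof (rule integral_directional_derivative_eq_0[where V = "V i" and N = "span {i}" and e = i and R = R,
        OF V_meas V_bd[OF i] _ g_meas AE_not_on_line _ _ g_bd[OF i]])
    show "V i y = 0" if "R < norm y" for y using that by (simp add: V_def out)
    show "1 < DIM('a)" using dim3 by simp
    show "y + s *\<^sub>R i \<notin> span {i}" if "y \<notin> span {i}" for y s
      using that by (metis span_add_eq2 span_base span_mul insertI1)
    fix y assume "y \<notin> span {i}"
    then have "y \<noteq> 0" using span_zero by auto
    note sd = space_derivs[OF this norm_Basis[OF i], of \<tau>]
    have "((\<lambda>s. f (x0 + (y + s *\<^sub>R i), t)) has_real_derivative D (x0 + y, t) (i, 0)) (at 0)"
      "((\<lambda>s. D (x0 + (y + s *\<^sub>R i), t) (i, 0)) has_real_derivative H (x0 + y, t) (i, 0) (i, 0)) (at 0)"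
      using derivs2_along_line[OF derivs, of "(x0 + y, t)" 0 "(i, 0)"] t by (simp_all add: add.assoc)
    from DERIV_diff[OF DERIV_mult[OF this(1) sd(2)] DERIV_mult[OF sd(1) this(2)]]
    show "((\<lambda>s. V i (y + s *\<^sub>R i)) has_real_derivative g i y) (at 0)"
      by (simp add: V_def g_def algebra_simps)
  qed
  have "H (x0 + y, t) (0, 1) (0, 1) * spherical_wave h0 y \<tau> - f (x0 + y, t) * spherical_wave h2 y \<tau> = - (\<Sum>i\<in>Basis. g i y)" for y
    by (simp add: g_def wave[OF t] laplace_profile[OF dim3, symmetric] sum_subtractf sum_distrib_left mult.commute)
  then show ?thesis using g_int g0 by simp
qed

text \<open>The conserved form \<integral> (p_t q - p q_t) for the backward wave q(y, t) = \<psi>(y,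
  t0 - t); the plus sign comes from q_t being minus the \<tau>-derivative of \<psi>.\<close>

definition pairing :: "'a \<Rightarrow> real \<Rightarrow> real \<Rightarrow> real" where
  "pairing x0 t0 t = (\<integral>y. D (x0 + y, t) (0, 1) * spherical_wave h0 y (t0 - t) + f (x0 + y, t) * spherical_wave h1 y (t0 - t) \<partial>lborel)"

text \<open>For all times in [0, t0] the test waves live in one ball, which yields a dominating
  function independent of the time.\<close>

lemma pairing_integrand:
  assumes "t0 > 0"
  shows "\<exists>C. \<forall>y t. 0 \<le> t \<longrightarrow> t \<le> t0 \<longrightarrow>
    \<bar>D (x0 + y, t) (0, 1) * spherical_wave h0 y (t0 - t) + f (x0 + y, t) * spherical_wave h1 y (t0 - t)\<bar>
      \<le> C * indicator (cball 0 (t0 + \<epsilon>)) y"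
proof -
  obtain M1 where M1: "M1 \<ge> 0" "\<And>y t. norm y \<le> t0 + \<epsilon> \<Longrightarrow> 0 \<le> t \<Longrightarrow> t \<le> t0 \<Longrightarrow> norm (f (x0 + y, t)) \<le> M1"
    using bounded_on_compact[OF contf, of 0 t0 "t0 + \<epsilon>" x0] by auto
  obtain M2 where M2: "M2 \<ge> 0" "\<And>y t. norm y \<le> t0 + \<epsilon> \<Longrightarrow> 0 \<le> t \<Longrightarrow> t \<le> t0 \<Longrightarrow> norm (D (x0 + y, t)) \<le> M2"
    using bounded_on_compact[OF contD, of 0 t0 "t0 + \<epsilon>" x0] by auto
  have "\<bar>D (x0 + y, t) (0, 1) * spherical_wave h0 y (t0 - t) + f (x0 + y, t) * spherical_wave h1 y (t0 - t)\<bar>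
      \<le> (M2 * (2 * B) + M1 * (2 * B)) * indicator (cball 0 (t0 + \<epsilon>)) y" if t: "0 \<le> t" "t \<le> t0" for y t
  proof (cases "norm y \<le> t0 + \<epsilon>")
    case True
    have "norm (D (x0 + y, t) (0, 1)) \<le> M2"
      by (intro blinfun_apply_bound M2 True t unit_directions)
    then have "\<bar>D (x0 + y, t) (0, 1) * spherical_wave h0 y (t0 - t)\<bar> + \<bar>f (x0 + y, t) * spherical_wave h1 y (t0 - t)\<bar>
        \<le> M2 * (2 * B) + M1 * (2 * B)"
      unfolding abs_mult using M1(1) M2(1) M1(2)[OF True t] spherical_wave_bounds[of y "t0 - t"]
      by (intro add_mono mult_mono) auto
    then show ?thesis using True by (simp add: order_trans[OF abs_triangle_ineq])
  next
    case False
    then have "norm y \<ge> \<bar>t0 - t\<bar> + \<epsilon>" using t by simp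
    then show ?thesis using False by (simp add: spherical_wave_eq_0)
  qed
  then show ?thesis by blast
qed

lemma pairing_measurable:
  assumes "t \<ge> 0"
  shows "(\<lambda>y. D (x0 + y, t) (0, 1) * spherical_wave h0 y \<tau> + f (x0 + y, t) * spherical_wave h1 y \<tau>) \<in> borel_measurable borel"
  by (intro borel_measurable_add borel_measurable_times measurable_slices assms measurable_spherical_wave measurable_profile)

text \<open>The two cross terms with first derivatives in time cancel; the rest is the integrand of
  \<open>green_identity\<close>.\<close>

lemma pairing_deriv:
  assumes t: "0 < t" "t < t0"
  shows "(pairing x0 t0 has_real_derivative 0) (at t)"
proof -
  define r where "r = min t (t0 - t) / 2"
  have r: "r > 0" "0 < t - r" "t + r < t0" using t by (auto simp: r_def min_def field_simps)
  have sub: "{t - r..t + r} \<subseteq> {0..}" "{t - r..t + r} \<subseteq> {0<..}" using r by auto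
  let ?R = "t0 + \<epsilon>"
  obtain M1 where M1: "M1 \<ge> 0" "\<And>y s. norm y \<le> ?R \<Longrightarrow> t - r \<le> s \<Longrightarrow> s \<le> t + r \<Longrightarrow> norm (f (x0 + y, s)) \<le> M1"
    using bounded_on_compact[OF contf sub(1), of ?R x0] by auto
  obtain M3 where M3: "M3 \<ge> 0" "\<And>y s. norm y \<le> ?R \<Longrightarrow> t - r \<le> s \<Longrightarrow> s \<le> t + r \<Longrightarrow> norm (H (x0 + y, s)) \<le> M3"
    using bounded_on_compact[OF derivs2D(4)[OF derivs] sub(2), of ?R x0] by auto
  obtain C where C: "\<And>y t. 0 \<le> t \<Longrightarrow> t \<le> t0 \<Longrightarrow> \<bar>D (x0 + y, t) (0, 1) * spherical_wave h0 y (t0 - t) + f (x0 + y, t) * spherical_wave h1 y (t0 - t)\<bar>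
      \<le> C * indicator (cball 0 (t0 + \<epsilon>)) y"
    using pairing_integrand[OF less_trans[OF t], of x0] by blast
  have "((\<lambda>t. \<integral>y. D (x0 + y, t) (0, 1) * spherical_wave h0 y (t0 - t) + f (x0 + y, t) * spherical_wave h1 y (t0 - t) \<partial>lborel)
     has_real_derivative (\<integral>y. H (x0 + y, t) (0, 1) (0, 1) * spherical_wave h0 y (t0 - t) - f (x0 + y, t) * spherical_wave h2 y (t0 - t) \<partial>lborel)) (at t)"
  proof (rule has_real_derivative_integral_dominated[OF r(1),
        where B = "\<lambda>y. (M3 * (2 * B) + M1 * (2 * B)) * indicator (cball 0 ?R) y"])
    fix s assume "\<bar>s - t\<bar> < r"
    then have s: "0 \<le> s" "s \<le> t0" using r by auto
    show "integrable lborel (\<lambda>y. D (x0 + y, s) (0, 1) * spherical_wave h0 y (t0 - s) + f (x0 + y, s) * spherical_wave h1 y (t0 - s))"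
      by (rule Bochner_Integration.integrable_bound[OF integrable_indicator_cball])
        (use pairing_measurable[OF s(1)] C[OF s] in \<open>auto intro!: AE_I2 order_trans[OF _ abs_ge_self]\<close>)
  next
    show "AE y in lborel. \<forall>s. \<bar>s - t\<bar> < r \<longrightarrow>
      ((\<lambda>t. D (x0 + y, t) (0, 1) * spherical_wave h0 y (t0 - t) + f (x0 + y, t) * spherical_wave h1 y (t0 - t)) has_real_derivative
        H (x0 + y, s) (0, 1) (0, 1) * spherical_wave h0 y (t0 - s) - f (x0 + y, s) * spherical_wave h2 y (t0 - s)) (at s) \<and>
      \<bar>H (x0 + y, s) (0, 1) (0, 1) * spherical_wave h0 y (t0 - s) - f (x0 + y, s) * spherical_wave h2 y (t0 - s)\<bar>
        \<le> (M3 * (2 * B) + M1 * (2 * B)) * indicator (cball 0 ?R) y"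
    proof (intro AE_I2 allI impI conjI)
      fix y s assume "\<bar>s - t\<bar> < r"
      then have s: "t - r \<le> s" "s \<le> t + r" "0 < s" "s < t0" using r by auto
      have rev_time: "((\<lambda>t. t0 - t) has_real_derivative - 1) (at s)"
        by (auto intro!: derivative_eq_intros)
      note q0 = DERIV_chain2[OF spherical_wave_deriv[OF d0] rev_time, of y] and q1 = DERIV_chain2[OF spherical_wave_deriv[OF d1] rev_time, of y]
      have "((\<lambda>t. f (x0 + y, t)) has_real_derivative D (x0 + y, s) (0, 1)) (at s)"
        "((\<lambda>t. D (x0 + y, t) (0, 1)) has_real_derivative H (x0 + y, s) (0, 1) (0, 1)) (at s)"
        using derivs2_along_line[OF derivs, of "(x0 + y, 0)" s "(0, 1)"] s by simp_all
      from DERIV_add[OF DERIV_mult[OF this(2) q0] DERIV_mult[OF this(1) q1]]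
      show "((\<lambda>t. D (x0 + y, t) (0, 1) * spherical_wave h0 y (t0 - t) + f (x0 + y, t) * spherical_wave h1 y (t0 - t)) has_real_derivative
        H (x0 + y, s) (0, 1) (0, 1) * spherical_wave h0 y (t0 - s) - f (x0 + y, s) * spherical_wave h2 y (t0 - s)) (at s)"
        by (rule DERIV_cong) (simp add: algebra_simps)
      show "\<bar>H (x0 + y, s) (0, 1) (0, 1) * spherical_wave h0 y (t0 - s) - f (x0 + y, s) * spherical_wave h2 y (t0 - s)\<bar>
        \<le> (M3 * (2 * B) + M1 * (2 * B)) * indicator (cball 0 ?R) y"
      proof (cases "norm y \<le> ?R")
        case True
        have "norm (H (x0 + y, s) (0, 1) (0, 1)) \<le> M3"
          by (intro blinfun_apply_bound M3 True s unit_directions)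
        then have "\<bar>H (x0 + y, s) (0, 1) (0, 1) * spherical_wave h0 y (t0 - s)\<bar> + \<bar>f (x0 + y, s) * spherical_wave h2 y (t0 - s)\<bar>
            \<le> M3 * (2 * B) + M1 * (2 * B)"
          unfolding abs_mult using M1(1) M3(1) M1(2)[OF True s(1,2)] spherical_wave_bounds[of y "t0 - s"]
          by (intro add_mono mult_mono) auto
        then show ?thesis using True by (simp add: order_trans[OF abs_triangle_ineq4])
      next
        case False
        then have "norm y \<ge> \<bar>t0 - s\<bar> + \<epsilon>" using s by simp
        then show ?thesis using False by (simp add: spherical_wave_eq_0)
      qed
    qed
    show "(\<lambda>y. H (x0 + y, t) (0, 1) (0, 1) * spherical_wave h0 y (t0 - t) - f (x0 + y, t) * spherical_wave h2 y (t0 - t)) \<in> borel_measurable lborel"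
      unfolding measurable_lborel2
      using t by (intro borel_measurable_diff borel_measurable_times measurable_slices measurable_spherical_wave measurable_profile) auto
  qed (rule integrable_indicator_cball)
  then show ?thesis
    unfolding green_identity[OF t(1)] pairing_def[abs_def] .
qed

text \<open>The derivative is available for 0 < t < t0 only; continuity carries the constancy to the
  two end times, where the pairing is evaluated.\<close>

lemma pairing_continuous:
  assumes "t0 > 0"
  shows "continuous_on {0..t0} (pairing x0 t0)"
proof -
  obtain C where C: "\<And>y t. 0 \<le> t \<Longrightarrow> t \<le> t0 \<Longrightarrow> \<bar>D (x0 + y, t) (0, 1) * spherical_wave h0 y (t0 - t) + f (x0 + y, t) * spherical_wave h1 y (t0 - t)\<bar>
      \<le> C * indicator (cball 0 (t0 + \<epsilon>)) y"
    using pairing_integrand[OF assms, of x0] by blast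
  show ?thesis
    unfolding pairing_def[abs_def]
  proof (rule continuous_on_integral_dominated[where B = "\<lambda>y. C * indicator (cball 0 (t0 + \<epsilon>)) y"])
    show "AE y in lborel. continuous_on {0..t0}
        (\<lambda>t. D (x0 + y, t) (0, 1) * spherical_wave h0 y (t0 - t) + f (x0 + y, t) * spherical_wave h1 y (t0 - t)) \<and>
      (\<forall>t\<in>{0..t0}. \<bar>D (x0 + y, t) (0, 1) * spherical_wave h0 y (t0 - t) + f (x0 + y, t) * spherical_wave h1 y (t0 - t)\<bar>
        \<le> C * indicator (cball 0 (t0 + \<epsilon>)) y)"
    proof (intro AE_I2 conjI ballI)
      fix y :: 'a
      have *: "continuous_on {0..t0} (\<lambda>t. t0 - t)" by (intro continuous_intros)
      have "continuous_on UNIV (spherical_wave h0 y)" "continuous_on UNIV (spherical_wave h1 y)"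
        using spherical_wave_deriv[OF d0] spherical_wave_deriv[OF d1]
        by (meson DERIV_isCont continuous_at_imp_continuous_on)+
      from this[THEN continuous_on_compose2, OF * subset_UNIV]
      show "continuous_on {0..t0} (\<lambda>t. D (x0 + y, t) (0, 1) * spherical_wave h0 y (t0 - t) + f (x0 + y, t) * spherical_wave h1 y (t0 - t))"
        by (intro continuous_on_add continuous_on_mult continuous_on_subset[OF continuous_in_time(1)]
            continuous_on_subset[OF continuous_in_time(2)]) auto
    qed (use C in simp)
    show "integrable lborel (\<lambda>y::'a. C * indicator (cball 0 (t0 + \<epsilon>)) y)"
      by (rule integrable_indicator_cball)
  qed (use pairing_measurable in simp)
qed

lemma pairing_constant:
  assumes "t0 > 0"
  shows "pairing x0 t0 t0 = pairing x0 t0 0"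
  using DERIV_isconst_end[OF assms pairing_continuous[OF assms]] pairing_deriv by blast

lemma weighted_mean_eq_0:
  assumes t0: "t0 > 0"
    and init: "\<And>x. norm x > \<rho> \<Longrightarrow> f (x, 0) = 0 \<and> D (x, 0) (0, 1) = 0"
    and cone: "norm x0 + \<rho> + \<epsilon> < t0"
  shows "(\<integral>y. f (x0 + y, t0) * spherical_wave h1 y 0 \<partial>lborel) = 0"
proof -
  have "D (x0 + y, 0) (0, 1) * spherical_wave h0 y (t0 - 0) + f (x0 + y, 0) * spherical_wave h1 y (t0 - 0) = 0" for y
  proof (cases "norm y \<le> t0 - \<epsilon>")
    case True
    then show ?thesis by (simp add: spherical_wave_eq_0)
  next
    case False
    \<comment> \<open>Here |x0 + y| \<ge> |y| - |x0| > t0 - \<epsilon> - |x0| > \<rho> by the cone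
      condition.\<close>
    then have "norm (x0 + y) > \<rho>" using cone norm_diff_ineq[of y x0] by (simp add: add.commute)
    then show ?thesis using init by simp
  qed
  then have "pairing x0 t0 0 = 0" unfolding pairing_def by simp
  moreover have "spherical_wave h0 y 0 = 0" for y :: 'a by (simp add: spherical_wave_def even)
  then have "pairing x0 t0 t0 = (\<integral>y. f (x0 + y, t0) * spherical_wave h1 y 0 \<partial>lborel)" unfolding pairing_def by simp
  ultimately show ?thesis using pairing_constant[OF t0, of x0] by simp
qed

end

section \<open>A concrete profile\<close>

definition bump :: "real \<Rightarrow> nat \<Rightarrow> real \<Rightarrow> real" where
  "bump \<epsilon> k s = (max 0 (\<epsilon>\<^sup>2 - s\<^sup>2)) ^ k"

lemma bump_deriv:
  "(bump \<epsilon> (k + 2) has_real_derivative real (k + 2) * bump \<epsilon> (k + 1) s * (- 2 * s)) (at s)"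
proof -
  have "((\<lambda>s. \<epsilon>\<^sup>2 - s\<^sup>2) has_real_derivative - 2 * s) (at s)"
    by (auto intro!: derivative_eq_intros)
  from DERIV_chain2[OF has_real_derivative_pos_part_power this, of k] show ?thesis
    by (simp add: bump_def[abs_def])
qed

lemma bump_eq_0: "\<epsilon> > 0 \<Longrightarrow> k > 0 \<Longrightarrow> \<bar>s\<bar> \<ge> \<epsilon> \<Longrightarrow> bump \<epsilon> k s = 0"
proof -
  assume *: "\<epsilon> > 0" "k > 0" "\<bar>s\<bar> \<ge> \<epsilon>"
  then have "\<epsilon>\<^sup>2 \<le> s\<^sup>2" by (simp add: abs_le_square_iff[symmetric])
  then show ?thesis using * by (simp add: bump_def max_def)
qed

lemma bump_nonneg: "bump \<epsilon> k s \<ge> 0"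
  by (simp add: bump_def)

lemma continuous_on_bump: "continuous_on S (bump \<epsilon> k)"
  unfolding bump_def[abs_def] by (intro continuous_intros)

lemma bounded_if_compact_support:
  fixes h :: "real \<Rightarrow> real"
  assumes "continuous_on UNIV h" "\<And>s. \<bar>s\<bar> \<ge> \<epsilon> \<Longrightarrow> h s = 0"
  shows "\<exists>B. \<forall>s. \<bar>h s\<bar> \<le> B"
proof -
  have "bounded (h ` {- \<epsilon>..\<epsilon>})"
    by (intro compact_imp_bounded compact_continuous_image continuous_on_subset[OF assms(1)]) auto
  then obtain B where B: "\<forall>v\<in>h ` {- \<epsilon>..\<epsilon>}. \<bar>v\<bar> \<le> B" unfolding bounded_iff real_norm_def by blast
  have "\<bar>h s\<bar> \<le> max 0 B" for s
  proof (cases "\<bar>s\<bar> \<ge> \<epsilon>")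
    case True
    then show ?thesis using assms(2) by simp
  next
    case False
    then have "h s \<in> h ` {- \<epsilon>..\<epsilon>}" by (intro imageI) auto
    then show ?thesis using B by (meson max.coboundedI2)
  qed
  then show ?thesis by blast
qed

text \<open>Each differentiation lowers the exponent by one. Starting from 4, the third derivative
  still has the factor \<open>bump \<epsilon> 1\<close>, so it is continuous with compact support
  and therefore bounded.\<close>

lemma radial_profile_bump:
  assumes \<epsilon>: "\<epsilon> > 0"
  shows "\<exists>B. radial_profile (bump \<epsilon> 4) (\<lambda>s. - 8 * s * bump \<epsilon> 3 s)
    (\<lambda>s. - 8 * bump \<epsilon> 3 s + 48 * s\<^sup>2 * bump \<epsilon> 2 s)
    (\<lambda>s. 144 * s * bump \<epsilon> 2 s - 192 * s ^ 3 * bump \<epsilon> 1 s) \<epsilon> B"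
    (is "\<exists>B. radial_profile ?h0 ?h1 ?h2 ?h3 \<epsilon> B")
proof -
  have b: "(bump \<epsilon> 4 has_real_derivative 4 * bump \<epsilon> 3 s * (- 2 * s)) (at s)"
    "(bump \<epsilon> 3 has_real_derivative 3 * bump \<epsilon> 2 s * (- 2 * s)) (at s)"
    "(bump \<epsilon> 2 has_real_derivative 2 * bump \<epsilon> 1 s * (- 2 * s)) (at s)" for s
    using bump_deriv[of \<epsilon> 2 s] bump_deriv[of \<epsilon> 1 s] bump_deriv[of \<epsilon> 0 s]
    by (simp_all add: eval_nat_numeral)
  have supp: "?h0 s = 0" "?h1 s = 0" "?h2 s = 0" "?h3 s = 0" if "\<bar>s\<bar> \<ge> \<epsilon>" for s
    using that \<epsilon> by (simp_all add: bump_eq_0)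
  have "\<exists>B. \<forall>s. \<bar>?h1 s\<bar> \<le> B" "\<exists>B. \<forall>s. \<bar>?h2 s\<bar> \<le> B" "\<exists>B. \<forall>s. \<bar>?h3 s\<bar> \<le> B"
    by (rule bounded_if_compact_support[where \<epsilon> = \<epsilon>],
        intro continuous_on_add continuous_on_diff continuous_on_mult continuous_on_power
          continuous_on_const continuous_on_id continuous_on_bump, erule supp)+
  then obtain B1 B2 B3 where B: "\<forall>s. \<bar>?h1 s\<bar> \<le> B1" "\<forall>s. \<bar>?h2 s\<bar> \<le> B2" "\<forall>s. \<bar>?h3 s\<bar> \<le> B3"
    by (elim exE)
  show ?thesis
  proof (intro exI[of _ "max B1 (max B2 B3)"], unfold_locales)
    show "(?h0 has_real_derivative ?h1 s) (at s)" for s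
      by (rule DERIV_cong[OF b(1)]) simp
    show "(?h1 has_real_derivative ?h2 s) (at s)" for s
      by (rule DERIV_cong[OF DERIV_mult[OF DERIV_cmult[OF DERIV_ident] b(2)]])
        (simp add: power2_eq_square algebra_simps)
    have "((\<lambda>s. 48 * s\<^sup>2) has_real_derivative 96 * s) (at s)" for s :: real
      by (auto intro!: derivative_eq_intros)
    from DERIV_add[OF DERIV_cmult[OF b(2)] DERIV_mult[OF this b(3)]]
    show "(?h2 has_real_derivative ?h3 s) (at s)" for s
      by (rule DERIV_cong) (simp add: power2_eq_square power3_eq_cube algebra_simps)
    show "\<bar>?h1 s\<bar> \<le> max B1 (max B2 B3) \<and> \<bar>?h2 s\<bar> \<le> max B1 (max B2 B3) \<and> \<bar>?h3 s\<bar> \<le> max B1 (max B2 B3)" for s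
      using B[THEN spec, of s] by (simp add: le_max_iff_disj)
    show "?h0 (- s) = ?h0 s" for s by (simp add: bump_def)
    show "?h0 s = 0 \<and> ?h1 s = 0 \<and> ?h2 s = 0" if "\<bar>s\<bar> \<ge> \<epsilon>" for s using supp[OF that] by blast
  qed (rule \<epsilon>)
qed

context wave_in_space begin

text \<open>A nonzero value at \<open>x0\<close> keeps its sign near \<open>x0\<close> by
  continuity. The weight in \<open>weighted_mean_eq_0\<close> also has one sign there, so the mean
  could not vanish.\<close>

lemma strong_huygens_principle:
  assumes t0: "t0 > 0"
    and init: "\<And>x. norm x > \<rho> \<Longrightarrow> f (x, 0) = 0 \<and> D (x, 0) (0, 1) = 0"
    and cone: "norm x0 + \<rho> < t0"
  shows "f (x0, t0) = 0"
proof (rule ccontr)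
  define c where "c = f (x0, t0)"
  assume "f (x0, t0) \<noteq> 0"
  then have c: "c \<noteq> 0" by (simp add: c_def)
  have cont: "continuous_on UNIV (\<lambda>y. f (x0 + y, t0))"
    using t0 by (intro continuous_slices) simp
  then have "isCont (\<lambda>y. f (x0 + y, t0)) 0" by (simp add: continuous_on_eq_continuous_at)
  from spec[OF this[unfolded continuous_at_eps_delta], of "\<bar>c\<bar> / 2"] c
  have "\<exists>d>0. \<forall>y. dist y 0 < d \<longrightarrow> dist (f (x0 + y, t0)) (f (x0 + 0, t0)) < \<bar>c\<bar> / 2"
    by simp
  then obtain d where d: "d > 0" "\<And>y. norm y < d \<Longrightarrow> \<bar>f (x0 + y, t0) - c\<bar> < \<bar>c\<bar> / 2"
    by (auto simp: c_def dist_norm)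
  \<comment> \<open>Halving makes both demands strict: the weight stays where \<open>f\<close> is
    close to \<open>c\<close>, and the cone condition survives the thickening by
    \<open>\<epsilon>\<close>.\<close>
  define \<epsilon> where "\<epsilon> = min d (t0 - norm x0 - \<rho>) / 2"
  have eps: "\<epsilon> > 0" "\<epsilon> < d" "norm x0 + \<rho> + \<epsilon> < t0"
    using d(1) cone by (auto simp: \<epsilon>_def min_def field_simps)
  let ?h1 = "\<lambda>s. - 8 * s * bump \<epsilon> 3 s"
  obtain B where "radial_profile (bump \<epsilon> 4) ?h1
    (\<lambda>s. - 8 * bump \<epsilon> 3 s + 48 * s\<^sup>2 * bump \<epsilon> 2 s)
    (\<lambda>s. 144 * s * bump \<epsilon> 2 s - 192 * s ^ 3 * bump \<epsilon> 1 s) \<epsilon> B"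
    using radial_profile_bump[OF eps(1)] by (elim exE)
  then interpret wave_test f D H "bump \<epsilon> 4" ?h1
    "\<lambda>s. - 8 * bump \<epsilon> 3 s + 48 * s\<^sup>2 * bump \<epsilon> 2 s"
    "\<lambda>s. 144 * s * bump \<epsilon> 2 s - 192 * s ^ 3 * bump \<epsilon> 1 s" \<epsilon> B
    by (intro wave_test.intro wave_in_space_axioms)
  have Q1: "spherical_wave ?h1 y 0 = (if y = 0 then 0 else - 16 * bump \<epsilon> 3 (norm y))" for y :: 'a
    by (simp add: spherical_wave_def bump_def field_simps)
  \<comment> \<open>The factor \<open>- c\<close> compensates the negative weight and the sign of
    \<open>c\<close>, so that \<open>k\<close> is nonnegative.\<close>
  define k where "k y = - c * (f (x0 + y, t0) * spherical_wave ?h1 y 0)" for y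
  have k0: "(\<integral>y. k y \<partial>lborel) = 0"
    unfolding k_def using weighted_mean_eq_0[OF t0 init eps(3)] by simp
  have k_lower: "k y \<ge> c\<^sup>2 / 2 * (16 * bump \<epsilon> 3 (norm y))" if "y \<noteq> 0" for y
  proof (cases "norm y < \<epsilon>")
    case True
    then have "\<bar>f (x0 + y, t0) - c\<bar> < \<bar>c\<bar> / 2" using d(2) eps(2) by auto
    then have "\<bar>c\<bar> * \<bar>f (x0 + y, t0) - c\<bar> \<le> \<bar>c\<bar> * (\<bar>c\<bar> / 2)" by (intro mult_left_mono) auto
    then have "\<bar>c * (f (x0 + y, t0) - c)\<bar> \<le> c\<^sup>2 / 2" by (simp add: abs_mult power2_eq_square)
    moreover have "c * f (x0 + y, t0) = c\<^sup>2 + c * (f (x0 + y, t0) - c)"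
      by (simp add: power2_eq_square algebra_simps)
    ultimately have "c * f (x0 + y, t0) \<ge> c\<^sup>2 / 2" by linarith
    then have "c\<^sup>2 / 2 * (16 * bump \<epsilon> 3 (norm y)) \<le> c * f (x0 + y, t0) * (16 * bump \<epsilon> 3 (norm y))"
      by (intro mult_right_mono) (auto simp: bump_nonneg)
    then show ?thesis using that unfolding k_def Q1 by (simp add: mult_ac)
  next
    case False
    then show ?thesis using eps(1) unfolding k_def Q1 by (simp add: bump_eq_0)
  qed
  \<comment> \<open>The lower bound for \<open>k\<close> on the punctured ball of radius
    \<open>\<epsilon> / 2\<close>, where \<epsilon>^2 - |y|^2 is at least 3/4 of
    \<epsilon>^2.\<close>
  define K where "K = c\<^sup>2 / 2 * (16 * (\<epsilon>\<^sup>2 * 3 / 4) ^ 3)"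
  have K: "K > 0" using c eps(1) by (simp add: K_def)
  obtain M where M: "M \<ge> 0" "\<And>y. norm y \<le> \<epsilon> \<Longrightarrow> norm (f (x0 + y, t0)) \<le> M"
    using bounded_on_compact[OF contf, of t0 t0 \<epsilon> x0] t0 by auto
  have k_out: "k y = 0" if "norm y > \<epsilon>" for y
    using that eps(1) unfolding k_def Q1 by (simp add: bump_eq_0)
  have "\<bar>k y\<bar> \<le> \<bar>c\<bar> * (M * (2 * B))" for y
  proof (cases "norm y \<le> \<epsilon>")
    case True
    have "\<bar>f (x0 + y, t0)\<bar> * \<bar>spherical_wave ?h1 y 0\<bar> \<le> M * (2 * B)"
      using M(1) M(2)[OF True] spherical_wave_bounds(2)[of y 0] by (intro mult_mono) auto
    then show ?thesis unfolding k_def abs_mult abs_minus_cancel by (rule mult_left_mono) simp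
  qed (use k_out M(1) B_nonneg in simp)
  moreover have "k \<in> borel_measurable borel"
    unfolding k_def[abs_def]
    by (intro borel_measurable_times borel_measurable_const borel_measurable_continuous_onI[OF cont]
        measurable_spherical_wave measurable_profile)
  ultimately have k_int: "integrable lborel k"
    using k_out by (intro integrable_bounded_support)
  have "0 < K * measure lborel (cball (0::'a) (\<epsilon> / 2))"
    using K eps(1) by (simp add: content_cball_pos)
  also have "\<dots> = (\<integral>y. K * indicator (cball (0::'a) (\<epsilon> / 2)) y \<partial>lborel)"
    using emeasure_lborel_cball_finite[of "0::'a" "\<epsilon> / 2"] by simp
  also have "\<dots> \<le> (\<integral>y. k y \<partial>lborel)"
  proof (rule integral_mono_AE[OF integrable_indicator_cball k_int])
    show "AE y in lborel. K * indicator (cball 0 (\<epsilon> / 2)) y \<le> k y"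
      \<comment> \<open>At the origin the weight is 0 by division by zero, so the pointwise bound
        fails there and is claimed almost everywhere.\<close>
      using AE_lborel_singleton[of "0::'a"]
    proof eventually_elim
      case (elim y)
      show ?case
      proof (cases "norm y \<le> \<epsilon> / 2")
        case True
        have "(norm y)\<^sup>2 \<le> (\<epsilon> / 2)\<^sup>2" using True by (intro power_mono) auto
        then have "\<epsilon>\<^sup>2 * 3 / 4 \<le> max 0 (\<epsilon>\<^sup>2 - (norm y)\<^sup>2)"
          by (intro order_trans[OF _ max.cobounded2]) (simp add: power_divide)
        then have "(\<epsilon>\<^sup>2 * 3 / 4) ^ 3 \<le> bump \<epsilon> 3 (norm y)"
          unfolding bump_def by (intro power_mono) auto
        then have "K \<le> c\<^sup>2 / 2 * (16 * bump \<epsilon> 3 (norm y))"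
          unfolding K_def by (intro mult_left_mono) auto
        then show ?thesis using k_lower[OF elim] True by simp
      next
        case False
        have "0 \<le> c\<^sup>2 / 2 * (16 * bump \<epsilon> 3 (norm y))" using bump_nonneg by simp
        then show ?thesis using k_lower[OF elim] False by simp
      qed
    qed
  qed
  finally show False using k0 by simp
qed

end

text \<open>The norm attains its maximum on the compact closure; a radius strictly below 1 is what
  leaves slack at time 2.\<close>

lemma support_radius:
  fixes S :: "'a::euclidean_space set"
  assumes "closure S \<subseteq> ball 0 1"
  obtains \<rho> where "0 \<le> \<rho>" "\<rho> < 1" "\<And>x. x \<in> S \<Longrightarrow> norm x \<le> \<rho>"
proof (cases "S = {}")
  case True
  then show ?thesis by (intro that[of 0]) auto
next
  case False
  have "compact (closure S)"
    using assms bounded_subset[OF bounded_ball] by (simp add: compact_eq_bounded_closed)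
  then obtain x where x: "x \<in> closure S" "\<forall>y\<in>closure S. norm y \<le> norm x"
    using continuous_attains_sup[of "closure S" norm] False by (auto intro: continuous_on_norm_id)
  show ?thesis
  proof (rule that[of "norm x"])
    show "norm x < 1" using x(1) assms by auto
    show "norm y \<le> norm x" if "y \<in> S" for y using x(2) that closure_subset[of S] by auto
  qed simp
qed

section \<open>Time reversal\<close>

text \<open>Carries Huygens' principle over to the solution class of the theorem, where the initial
  velocity is a one-sided derivative and has to be identified with
  \<open>D (x, 0) (0, 1)\<close>.\<close>

proposition cauchy_solution_vanishes_in_cone:
  assumes p: "cauchy_solution a b p"
    and supp: "\<And>x. norm x > \<rho> \<Longrightarrow> a x = 0 \<and> b x = 0"
    and cone: "0 < t" "norm x + \<rho> < t"
  shows "p x t = 0"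
proof -
  let ?f = "\<lambda>(x, t). p x t" and ?Q = "(UNIV :: (real^3) set) \<times> {0::real<..}" and ?K = "(UNIV :: (real^3) set) \<times> {0::real..}"
  have C2: "C2_on ?f ?Q" and C1: "C1_on ?f ?K" and weq: "\<And>x t. t > 0 \<Longrightarrow> wave_eq_at p x t"
    and p0: "\<And>x. p x 0 = a x" and p1: "\<And>x. ((\<lambda>t. p x t) has_real_derivative b x) (at 0 within {0..})"
    using p unfolding cauchy_solution_def by blast+
  have Q: "open ?Q" "?Q \<subseteq> ?K" by (auto intro: open_Times)
  obtain D H where derivs: "derivs2 ?Q ?f D H" and cD: "continuous_on ?K D"
      and D: "\<forall>z\<in>?K. (?f has_derivative blinfun_apply (D z)) (at z within ?K)"
    by (rule C2_on_C1_on_derivs2[OF C2 C1 Q])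
  interpret wave_in_space ?f D H
  proof
    fix x :: "real^3" and t :: real assume "t > 0"
    then show "H (x, t) (0, 1) (0, 1) = (\<Sum>i\<in>Basis. H (x, t) (i, 0) (i, 0))"
      using wave_eq_at_derivs2[OF derivs, of x t] weq by simp
  qed (use derivs cD C1_on_imp_continuous_on[OF C1] in auto)
  have "D (x, 0) (0, 1) = b x" for x
  proof -
    have "((\<lambda>t. p x t) has_real_derivative D (x, 0) (0, 1)) (at 0 within {0..})"
      by (rule has_real_derivative_time[OF bspec[OF D]]) auto
    from real_derivative_unique_interval[OF _ _ has_field_derivative_subset[OF this] has_field_derivative_subset[OF p1], of 0 1]
    show ?thesis by simp
  qed
  then have "?f (x, t) = 0"
    using supp p0 by (intro strong_huygens_principle[OF cone(1) _ cone(2)]) auto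
  then show ?thesis by simp
qed

text \<open>Reversal replaces the direction (0, 1) by its negative, and the second derivative is
  quadratic in the direction.\<close>

lemma wave_eq_at_time_reversal:
  fixes p :: "'a::euclidean_space \<Rightarrow> real \<Rightarrow> real"
  assumes C2: "C2_on (\<lambda>(x, t). p x t) (UNIV \<times> {0<..})" and t: "t < T" and eq: "wave_eq_at p x (T - t)"
  shows "wave_eq_at (\<lambda>x s. p x (T - s)) x t"
proof -
  have op: "open ((UNIV :: 'a set) \<times> {0::real<..})" by (intro open_Times) auto
  obtain D H where H: "derivs2 (UNIV \<times> {0<..}) (\<lambda>(x, t). p x t) D H"
    by (rule C2_on_imp_derivs2[OF C2 op])
  have "(0::'a, - 1::real) = - (0, 1)" by simp
  then have "H z (0, - 1) (0, - 1) = H z (0, 1) (0, 1)" for z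
    by (simp only: blinfun.minus_right blinfun.minus_left minus_minus)
  then have "(deriv ^^ 2) (\<lambda>s. p x (T - s)) t = (deriv ^^ 2) (\<lambda>s. p x s) (T - t)"
    using derivs2_deriv2[OF H, of "(x, T)" t "(0, - 1)"] derivs2_deriv2[OF H, of "(x, 0)" "T - t" "(0, 1)"] t
    by simp
  then show ?thesis using eq by (simp add: wave_eq_at_def)
qed

text \<open>\<open>deriv\<close> is additive only where the derivatives exist, so the difference is
  formed at the level of \<open>H\<close>.\<close>

lemma wave_eq_at_diff:
  fixes u v :: "'a::euclidean_space \<Rightarrow> real \<Rightarrow> real"
  assumes u: "C2_on (\<lambda>(x, t). u x t) S" and v: "C2_on (\<lambda>(x, t). v x t) S" and S: "open S" "(x, t) \<in> S"
    and eq: "wave_eq_at u x t" "wave_eq_at v x t"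
  shows "wave_eq_at (\<lambda>x t. u x t - v x t) x t"
proof -
  obtain D H where H: "derivs2 S (\<lambda>(x, t). u x t) D H" by (rule C2_on_imp_derivs2[OF u S(1)])
  obtain E K where K: "derivs2 S (\<lambda>(x, t). v x t) E K" by (rule C2_on_imp_derivs2[OF v S(1)])
  have "(\<lambda>z. (case z of (x, t) \<Rightarrow> u x t) - (case z of (x, t) \<Rightarrow> v x t)) = (\<lambda>(x, t). u x t - v x t)" by auto
  with derivs2_diff[OF H K] have d: "derivs2 S (\<lambda>(x, t). u x t - v x t) (\<lambda>z. D z - E z) (\<lambda>z. H z - K z)" by simp
  show ?thesis
    using eq wave_eq_at_derivs2[OF H S(2)] wave_eq_at_derivs2[OF K S(2)]
    unfolding wave_eq_at_derivs2[OF d S(2)] by (simp add: blinfun.diff_left sum_subtractf)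
qed

theorem mainTheorem2:
  fixes a b :: "real^3 \<Rightarrow> real"
    and p u F Ft :: "real^3 \<Rightarrow> real \<Rightarrow> real"
    and T :: real
  assumes "closure {x. a x \<noteq> 0} \<subseteq> ball 0 1"
    and "closure {x. b x \<noteq> 0} \<subseteq> ball 0 1"
    and "cauchy_solution a b p"
    and "T \<ge> 2"
    and "\<And>x t. x \<in> sphere 0 1 \<Longrightarrow> t \<in> {0..T} \<Longrightarrow> F x t = p x t"
    and "\<And>x t. x \<in> sphere 0 1 \<Longrightarrow> t \<in> {0..2} \<Longrightarrow> Ft x t = F x (2 - t)"
    and "interior_solution Ft u"
  shows "\<forall>x\<in>cball 0 1. a x = u x 2 \<and>
           ((\<lambda>t. u x t) has_real_derivative - b x) (at 2 within {0..2})"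
proof -
  obtain \<rho>1 where \<rho>1: "0 \<le> \<rho>1" "\<rho>1 < 1" "\<And>x. x \<in> {x. a x \<noteq> 0} \<Longrightarrow> norm x \<le> \<rho>1"
    by (rule support_radius[OF assms(1)]) blast
  obtain \<rho>2 where \<rho>2: "0 \<le> \<rho>2" "\<rho>2 < 1" "\<And>x. x \<in> {x. b x \<noteq> 0} \<Longrightarrow> norm x \<le> \<rho>2"
    by (rule support_radius[OF assms(2)]) blast
  define \<rho> where "\<rho> = max \<rho>1 \<rho>2"
  have \<rho>: "0 \<le> \<rho>" "\<rho> < 1" using \<rho>1(1,2) \<rho>2(2) by (auto simp: \<rho>_def)
  have supp: "a x = 0 \<and> b x = 0" if "norm x > \<rho>" for x
    using \<rho>1(3)[of x] \<rho>2(3)[of x] that by (fastforce simp: \<rho>_def)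
  \<comment> \<open>For |x| \<le> 1 the cone condition |x| + \<rho> < t follows from t > 1 + \<rho>,
    a bound that lies strictly below 2.\<close>
  have late: "p x t = 0" if "norm x \<le> 1" "t > 1 + \<rho>" for x t
    by (rule cauchy_solution_vanishes_in_cone[OF assms(3) supp]) (use that \<rho> in auto)
  have pC2: "C2_on (\<lambda>(x, t). p x t) (UNIV \<times> {0<..})" and pC1: "C1_on (\<lambda>(x, t). p x t) (UNIV \<times> {0..})"
    and pweq: "\<And>x t. t > 0 \<Longrightarrow> wave_eq_at p x t"
    and p0: "\<And>x. p x 0 = a x" and p1: "\<And>x. ((\<lambda>t. p x t) has_real_derivative b x) (at 0 within {0..})"
    using assms(3) unfolding cauchy_solution_def by blast+
  have uC2: "C2_on (\<lambda>(x, t). u x t) (ball 0 1 \<times> {0<..<2})"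
    and uC1: "C1_on (\<lambda>(x, t). u x t) (cball 0 1 \<times> {0..2})"
    and uweq: "\<And>x t. x \<in> ball 0 1 \<Longrightarrow> t \<in> {0<..<2} \<Longrightarrow> wave_eq_at u x t"
    and ubd: "\<And>x t. x \<in> sphere 0 1 \<Longrightarrow> t \<in> {0..2} \<Longrightarrow> u x t = Ft x t"
    and u0: "\<And>x. x \<in> ball 0 1 \<Longrightarrow> u x 0 = 0"
    and u1: "\<And>x. x \<in> ball 0 1 \<Longrightarrow> ((\<lambda>t. u x t) has_real_derivative 0) (at 0 within {0..2})"
    using assms(7) unfolding interior_solution_def by blast+
  let ?q = "\<lambda>x t. p x (2 - t)"
  have L: "bounded_linear (\<lambda>z :: (real^3) \<times> real. (fst z, - snd z))"
    by (intro bounded_linear_Pair bounded_linear_fst bounded_linear_minus bounded_linear_snd)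
  have q: "(\<lambda>z. (\<lambda>(x, t). p x t) ((0, 2) + (fst z, - snd z))) = (\<lambda>(x, t). ?q x t)"
    by auto
  have qC2: "C2_on (\<lambda>(x, t). ?q x t) (ball 0 1 \<times> {0<..<2})"
    using C2_on_affine[OF pC2 L, of "ball 0 1 \<times> {0<..<2}" "(0, 2)"] unfolding q by auto
  have qC1: "C1_on (\<lambda>(x, t). ?q x t) (cball 0 1 \<times> {0..2})"
    using C1_on_affine[OF pC1 L, of "cball 0 1 \<times> {0..2}" "(0, 2)"] unfolding q by auto
  have diff: "(\<lambda>z. (\<lambda>(x, t). u x t) z - (\<lambda>(x, t). ?q x t) z) = (\<lambda>(x, t). u x t - ?q x t)"
    by auto
  have eq0: "u x t - ?q x t = 0" if "x \<in> cball 0 1" "t \<in> {0..2}" for x t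
  proof (rule wave_equation_unique_in_ball[where T = 2 and w = "\<lambda>x t. u x t - ?q x t"])
    show "C2_on (\<lambda>(x, t). u x t - ?q x t) (ball 0 1 \<times> {0<..<2})"
      using C2_on_diff[OF uC2 qC2] unfolding diff .
    show "C1_on (\<lambda>(x, t). u x t - ?q x t) (cball 0 1 \<times> {0..2})"
      using C1_on_diff[OF uC1 qC1] unfolding diff .
  next
    fix x :: "real^3" and t :: real assume xt: "x \<in> ball 0 1" "t \<in> {0<..<2}"
    then have "wave_eq_at ?q x t"
      by (intro wave_eq_at_time_reversal[OF pC2] pweq) auto
    then show "wave_eq_at (\<lambda>x t. u x t - ?q x t) x t"
      using xt by (intro wave_eq_at_diff[OF uC2 qC2] uweq) (auto intro: open_Times)
  next
    fix x :: "real^3" and t :: real assume xt: "x \<in> sphere 0 1" "t \<in> {0..2}"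
    \<comment> \<open>This is where T \<ge> 2 enters: the reversed times must lie in the window in
      which \<open>F\<close> is known.\<close>
    then have "2 - t \<in> {0..T}" using assms(4) by auto
    then show "u x t - ?q x t = 0"
      using ubd[OF xt] assms(6)[OF xt] assms(5)[OF xt(1)] by simp
  next
    fix x :: "real^3" assume x: "x \<in> ball 0 1"
    then show "u x 0 - ?q x 0 = 0" using u0[OF x] late[of x 2] \<rho> by simp
    \<comment> \<open>For t < 1 - \<rho> the reversed time 2 - t exceeds 1 + \<rho>, so the reversed
      solution is identically 0 near t = 0.\<close>
    have "(?q x has_real_derivative 0) (at 0 within {0..2})"
      by (rule has_field_derivative_transform_within[OF DERIV_const, of "1 - \<rho>"])
        (use \<rho> x late[of x] in \<open>auto simp: dist_real_def\<close>)
    from DERIV_diff[OF u1[OF x] this]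
    show "((\<lambda>t. u x t - ?q x t) has_real_derivative 0) (at 0 within {0..2})" by simp
  qed (use that in auto)
  show ?thesis
  proof (intro ballI conjI)
    fix x :: "real^3" assume x: "x \<in> cball 0 1"
    show "a x = u x 2" using eq0[OF x, of 2] p0[of x] by simp
    have "((\<lambda>t. 2 - t) has_real_derivative - 1) (at 2 within {0..2})"
      by (auto intro!: derivative_eq_intros)
    \<comment> \<open>The reflection maps [0, 2] into the half-line on which the initial velocity is
      defined; its derivative -1 gives the sign in front of \<open>b x\<close>.\<close>
    moreover have "((\<lambda>t. p x t) has_real_derivative b x) (at (2 - 2) within (\<lambda>t. 2 - t) ` {0..2})"
      using has_field_derivative_subset[OF p1, of "(\<lambda>t. 2 - t) ` {0..2}"] by auto
    ultimately have "((\<lambda>t. p x t) \<circ> (\<lambda>t. 2 - t) has_real_derivative b x * - 1) (at 2 within {0..2})"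
      by (intro DERIV_image_chain)
    then have "(?q x has_real_derivative - b x) (at 2 within {0..2})" by (simp add: o_def)
    then show "((\<lambda>t. u x t) has_real_derivative - b x) (at 2 within {0..2})"
      by (rule has_field_derivative_transform_within[OF _ zero_less_one])
        (use eq0[OF x] in auto)
  qed
qed

end
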